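(* Let $Y=\mu+\xi$ with $\mu\in\mathbb{R}^n$, $\xi\sim\mathcal{N}(0,\sigma^2I_n)$, let $p\ge3$, let $X_1,\dots,X_p\in\mathbb{R}^n$ satisfy $\max_j\|X_j\|^2\le B^2$ for some $B>0$, with $n\times p$ design matrix $\mathbb{X}=[X_1,\dots,X_p]$, let $\hat\mu_J=A_JY$, $J\subset[p]$, be the least squares estimators and $\pi$ the sparsity prior (both defined in the context), and let $\delta\in(0,1)$. Then each of the following statements holds with probability at least $1-\delta$: (i) The $Q$-aggregate estimator $\hat\mu^Q$ with $\lambda=20\sigma^2$ (and $\nu=1/2$) satisfies $$\|\hat\mu^Q-\mu\|^2\le\inf_{0\le q\le1}\min_{\beta\in\mathbb{R}^p}\big\{\|\mathbb{X}\beta-\mu\|^2+\varphi_{q,p}(\beta;9\sigma,B)\big\}.$$ (ii) The aggregate with exponential weights $\hat\mu^{\mathsf{EW}}$ with $\lambda=64\sigma^2$ satisfies $$\|\hat\mu^{\mathsf{EW}}-\mu\|^2\le\frac53\inf_{0\le q\le1}\min_{\beta\in\mathbb{R}^p}\big\{\|\mathbb{X}\beta-\mu\|^2+\varphi_{q,p}(\beta;16\sigma,B)\big\}.$$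
   Context: $[p]=\{1,\dots,p\}$; $\|\cdot\|$ is the Euclidean norm; $\mu$ is deterministic and unknown, $\sigma>0$ known. For $\beta\in\mathbb{R}^p\setminus\{0\}$, $|\beta|_0$ is the number of nonzero coefficients of $\beta$, and by convention $|0|_0=1$. For $q\in(0,1]$, $|\beta|_q=(\sum_j|\beta_j|^q)^{1/q}$. Let $\overline{\log}(x)=\max(\log x,1)$ and $$\varphi_{q,p}(\beta;\tau,B)=\max\Big\{9\tau^{2-q}|\beta|_q^qB^q\Big[\overline{\log}\Big(\frac{ep\,\tau^q}{B^q|\beta|_q^q\delta}\Big)\Big]^{1-\frac q2},\ 3\tau^2\,\overline{\log}\Big(\frac{ep}{\delta}\Big)\Big\},$$ with the convention $|\beta|_0^0=|\beta|_0$ for $q=0$ (and the first term read as $0$ if $q>0$ and $\beta=0$). For $J\subset[p]$, $\mathbb{X}_J$ is the $n\times|J|$ matrix with columns $X_j$, $j\in J$, and $A_J=\mathbb{X}_J(\mathbb{X}_J^\top\mathbb{X}_J)^\dagger\mathbb{X}_J^\top$ is the orthogonal projection onto the span of $\{X_j\}_{j\in J}$ ($^\dagger$ denotes the Moore–Penrose pseudoinverse; $A_\emptyset=0$). Put $C_J=4\sigma^2\,\mathrm{Tr}(A_J)=4\sigma^2\,\mathrm{rank}(\mathbb{X}_J)$. The sparsity prior is the probability distribution on subsets of $[p]$ with $\pi_J\propto e^{-|J|}/\binom{p}{|J|}$. Let $\Lambda$ be the set of probability vectors $\theta=(\theta_J)_{J\subset[p]}$, $\mu_\theta=\sum_J\theta_J\hat\mu_J$,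 and $\mathcal{K}(\theta,\pi)=\sum_J\theta_J\log(\theta_J/\pi_J)$ (with $0\log0=0$). The $Q$-aggregate estimator with parameters $\nu\in(0,1)$, $\lambda>0$ is $\hat\mu^Q=\mu_{\hat\theta}$, $\hat\theta\in\mathrm{argmin}_{\theta\in\Lambda}Q(\theta)$, where $$Q(\theta)=\nu\sum_J\theta_J\|Y-\hat\mu_J\|^2+(1-\nu)\|Y-\mu_\theta\|^2+\sum_J\theta_JC_J+\lambda\mathcal{K}(\theta,\pi);$$ here $\nu=1/2$. The aggregate with exponential weights with parameter $\lambda$ is $\hat\mu^{\mathsf{EW}}=\sum_J\hat\theta_J\hat\mu_J$ with $\hat\theta\in\Lambda$, $\hat\theta_J\propto\pi_J\exp\big(-(\|Y-\hat\mu_J\|^2+C_J)/\lambda\big)$. *)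

theory Defs
  imports "HOL-Probability.Probability" "HOL-Real_Asymp.Real_Asymp"
begin

subsection \<open>Moore--Penrose pseudoinverse and least squares projections\<close>

definition moore_penrose :: "real^'m^'n \<Rightarrow> real^'n^'m \<Rightarrow> bool" where
  "moore_penrose A B \<longleftrightarrow>
     A ** B ** A = A \<and> B ** A ** B = B \<and>
     transpose (A ** B) = A ** B \<and> transpose (B ** A) = B ** A"

definition pinv :: "real^'m^'n \<Rightarrow> real^'n^'m" where
  "pinv A = (THE B. moore_penrose A B)"

text \<open>The columns outside \<open>J\<close> are set to zero instead of being removed, because the number of
  columns is part of the type. This changes neither the column span nor
  \<open>X\<^sub>J (X\<^sub>J\<^sup>T X\<^sub>J)\<^sup>\<dagger> X\<^sub>J\<^sup>T\<close>: the Gram matrix only acquires zero rows and columns, and so does its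
  pseudoinverse.\<close>

definition restrict_cols :: "real^'p^'n \<Rightarrow> 'p set \<Rightarrow> real^'p^'n" where
  "restrict_cols X J = (\<chi> i j. if j \<in> J then X $ i $ j else 0)"

definition proj_mat :: "real^'p^'n \<Rightarrow> 'p set \<Rightarrow> real^'n^'n" where
  "proj_mat X J =
     (let XJ = restrict_cols X J in XJ ** pinv (transpose XJ ** XJ) ** transpose XJ)"

definition least_squares :: "real^'p^'n \<Rightarrow> 'p set \<Rightarrow> real^'n \<Rightarrow> real^'n" where
  "least_squares X J y = proj_mat X J *v y"

definition C_pen :: "real^'p^'n \<Rightarrow> real \<Rightarrow> 'p set \<Rightarrow> real" where
  "C_pen X \<sigma> J = 4 * \<sigma>\<^sup>2 * trace (proj_mat X J)"


subsection \<open>Aggregation over subsets with the sparsity prior\<close>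

text \<open>Weights indexed by the subsets of the index type \<open>'p\<close> are vectors of type
  \<open>real^('p set)\<close>.\<close>

definition prior_weight :: "'p::finite set \<Rightarrow> real" where
  "prior_weight J = exp (- real (card J)) / real (CARD('p) choose card J)"

definition sparsity_prior :: "real^('p::finite set)" where
  "sparsity_prior = (\<chi> J. prior_weight J / (\<Sum>K\<in>(UNIV :: 'p set set). prior_weight K))"

definition prob_vectors :: "(real^'k) set" where
  "prob_vectors = {\<theta>. (\<forall>k. 0 \<le> \<theta> $ k) \<and> (\<Sum>k\<in>UNIV. \<theta> $ k) = 1}"

text \<open>Since \<open>0 * ln 0 = 0\<close> in HOL, the convention \<open>0 log 0 = 0\<close> is built in.\<close>

definition KL :: "real^'k \<Rightarrow> real^'k \<Rightarrow> real" where
  "KL \<theta> \<pi> = (\<Sum>k\<in>UNIV. \<theta> $ k * ln (\<theta> $ k / \<pi> $ k))"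

definition mix :: "real^'p^'n \<Rightarrow> real^'n \<Rightarrow> real^('p set) \<Rightarrow> real^'n" where
  "mix X y \<theta> = (\<Sum>J\<in>UNIV. \<theta> $ J *\<^sub>R least_squares X J y)"

definition Q_fun :: "real^'p^'n \<Rightarrow> real \<Rightarrow> real \<Rightarrow> real \<Rightarrow> real^'n \<Rightarrow> real^('p set) \<Rightarrow> real" where
  "Q_fun X \<sigma> \<nu> lam y \<theta> =
     \<nu> * (\<Sum>J\<in>UNIV. \<theta> $ J * (norm (y - least_squares X J y))\<^sup>2)
     + (1 - \<nu>) * (norm (y - mix X y \<theta>))\<^sup>2
     + (\<Sum>J\<in>UNIV. \<theta> $ J * C_pen X \<sigma> J)
     + lam * KL \<theta> sparsity_prior"

text \<open>The estimator is a function of the observation \<open>y\<close>; any choice of minimizers is allowed.\<close>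

definition is_Q_aggregate ::
    "real^'p^'n \<Rightarrow> real \<Rightarrow> real \<Rightarrow> real \<Rightarrow> (real^'n \<Rightarrow> real^'n) \<Rightarrow> bool" where
  "is_Q_aggregate X \<sigma> \<nu> lam muhat \<longleftrightarrow>
     (\<forall>y. \<exists>\<theta>. is_arg_min (Q_fun X \<sigma> \<nu> lam y) (\<lambda>\<theta>. \<theta> \<in> prob_vectors) \<theta> \<and> muhat y = mix X y \<theta>)"

definition EW_weight :: "real^'p^'n \<Rightarrow> real \<Rightarrow> real \<Rightarrow> real^'n \<Rightarrow> 'p set \<Rightarrow> real" where
  "EW_weight X \<sigma> lam y J =
     sparsity_prior $ J * exp (- ((norm (y - least_squares X J y))\<^sup>2 + C_pen X \<sigma> J) / lam)"

definition EW_aggregate :: "real^'p^'n \<Rightarrow> real \<Rightarrow> real \<Rightarrow> real^'n \<Rightarrow> real^'n" where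
  "EW_aggregate X \<sigma> lam y =
     mix X y (\<chi> J. EW_weight X \<sigma> lam y J / (\<Sum>K\<in>UNIV. EW_weight X \<sigma> lam y K))"


subsection \<open>The remainder term\<close>

definition logbar :: "real \<Rightarrow> real" where
  "logbar x = max (ln x) 1"

definition l0 :: "real^'p \<Rightarrow> nat" where
  "l0 \<beta> = (if \<beta> = 0 then 1 else card {j. \<beta> $ j \<noteq> 0})"

definition lq :: "real \<Rightarrow> real^'p \<Rightarrow> real" where
  "lq q \<beta> = (\<Sum>j\<in>UNIV. \<bar>\<beta> $ j\<bar> powr q) powr (1 / q)"

definition lq_pow :: "real \<Rightarrow> real^'p \<Rightarrow> real" where
  "lq_pow q \<beta> = (if q = 0 then real (l0 \<beta>) else lq q \<beta> powr q)"

text \<open>For \<open>q > 0\<close> and \<open>\<beta> = 0\<close> the factor \<open>lq_pow q \<beta>\<close> vanishes, so the first term is \<open>0\<close>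
  as required by the usual convention.\<close>

definition phi :: "real \<Rightarrow> real^'p \<Rightarrow> real \<Rightarrow> real \<Rightarrow> real \<Rightarrow> real" where
  "phi q \<beta> \<tau> B \<delta> =
     (let p = real CARD('p) in
      max (9 * \<tau> powr (2 - q) * lq_pow q \<beta> * B powr q
             * logbar (exp 1 * p * \<tau> powr q / (B powr q * lq_pow q \<beta> * \<delta>)) powr (1 - q / 2))
          (3 * \<tau>\<^sup>2 * logbar (exp 1 * p / \<delta>)))"


subsection \<open>The definitions are meaningful\<close>

lemma moore_penrose_unique:
  assumes "moore_penrose A B" "moore_penrose A C"
  shows "B = C"
proof -
  note b = assms(1)[unfolded moore_penrose_def] and c = assms(2)[unfolded moore_penrose_def]
  have "A ** B = (A ** C) ** (A ** B)"
    using c by (metis matrix_mul_assoc)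
  also have "\<dots> = transpose ((A ** B) ** (A ** C))"
    using b c by (metis matrix_transpose_mul)
  also have "\<dots> = A ** C"
    using b c by (metis matrix_mul_assoc)
  finally have 1: "A ** B = A ** C" .
  have "B ** A = (B ** A) ** (C ** A)"
    using c by (metis matrix_mul_assoc)
  also have "\<dots> = transpose ((C ** A) ** (B ** A))"
    using b c by (metis matrix_transpose_mul)
  also have "\<dots> = C ** A"
    using b c by (metis matrix_mul_assoc)
  finally have 2: "B ** A = C ** A" .
  show ?thesis
    using b c 1 2 by (metis matrix_mul_assoc)
qed

lemma orth_proj_linear_exists:
  fixes S :: "(real^'n) set"
  assumes "subspace S"
  obtains P where "linear P" "\<And>x. P x \<in> S" "\<And>x. x \<in> S \<Longrightarrow> P x = x"
    "\<And>x s. s \<in> S \<Longrightarrow> (x - P x) \<bullet> s = 0"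
proof -
  obtain B where B: "B \<subseteq> S" "pairwise orthogonal B" "\<And>x. x \<in> B \<Longrightarrow> norm x = 1"
      "independent B" "span B = S"
    using orthonormal_basis_subspace[OF assms] by metis
  have fB: "finite B" using B(4) independent_imp_finite by blast
  define P where "P x = (\<Sum>b\<in>B. (x \<bullet> b) *\<^sub>R b)" for x
  have lin: "linear P"
    unfolding P_def by (intro linearI)
      (simp_all add: inner_add_left scaleR_add_left sum.distrib scaleR_sum_right)
  have inS: "P x \<in> S" for x
    unfolding P_def using B(1) assms
    by (intro subspace_sum) (auto intro: subspace_scale)
  have ortho: "(x - P x) \<bullet> s = 0" if "s \<in> S" for x s
  proof -
    have "orthogonal (x - P x) b" if b: "b \<in> B" for b
    proof -
      have "P x \<bullet> b = (\<Sum>c\<in>B. if c = b then x \<bullet> b else 0)"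
        unfolding P_def inner_sum_left
      proof (intro sum.cong refl)
        fix c assume c: "c \<in> B"
        show "(x \<bullet> c) *\<^sub>R c \<bullet> b = (if c = b then x \<bullet> b else 0)"
        proof (cases "c = b")
          case True
          then show ?thesis using B(3)[OF b] by (simp add: dot_square_norm)
        next
          case False
          then have "c \<bullet> b = 0"
            using B(2) b c by (auto simp: pairwise_def orthogonal_def)
          then show ?thesis using False by simp
        qed
      qed
      also have "\<dots> = x \<bullet> b" using b fB by simp
      finally show ?thesis by (simp add: orthogonal_def inner_diff_left)
    qed
    then have "orthogonal (x - P x) s"
      using orthogonal_to_span[of s B] that B(5) by blast
    then show ?thesis by (simp add: orthogonal_def)
  qed
  have "P x = x" if "x \<in> S" for x
  proof -
    have "x - P x \<in> S" using that inS assms by (simp add: subspace_diff)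
    from ortho[OF this, of x] show ?thesis by simp
  qed
  with lin inS ortho show ?thesis using that by blast
qed

lemma symmetric_matrixI:
  fixes A :: "real^'n^'n"
  assumes "\<And>x y. (A *v x) \<bullet> y = x \<bullet> (A *v y)"
  shows "transpose A = A"
proof -
  have "(transpose A *v x) \<bullet> y = (A *v x) \<bullet> y" for x y
    using assms[of x y] by (metis dot_lmul_matrix transpose_matrix_vector)
  then have "transpose A *v x = A *v x" for x
    by (metis vector_eq_rdot)
  then show ?thesis by (simp add: matrix_eq)
qed

lemma inner_transpose_mult:
  fixes A :: "real^'m^'n"
  shows "(A *v x) \<bullet> y = x \<bullet> (transpose A *v y)"
  by (metis dot_lmul_matrix inner_commute transpose_matrix_vector)

lemma moore_penrose_exists:
  fixes A :: "real^'m^'n"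
  shows "\<exists>B. moore_penrose A B"
proof -
  define R where "R = range ((*v) A)"
  define S where "S = range ((*v) (transpose A))"
  have subR: "subspace R" unfolding R_def
    by (intro linear_subspace_image) auto
  have subS: "subspace S" unfolding S_def
    by (intro linear_subspace_image) auto
  obtain P where P: "linear P" "\<And>x. P x \<in> R" "\<And>x. x \<in> R \<Longrightarrow> P x = x"
    "\<And>x s. s \<in> R \<Longrightarrow> (x - P x) \<bullet> s = 0"
    using orth_proj_linear_exists[OF subR] by metis
  obtain T where T: "linear T" "\<And>x. T x \<in> S" "\<And>x. x \<in> S \<Longrightarrow> T x = x"
    "\<And>x s. s \<in> S \<Longrightarrow> (x - T x) \<bullet> s = 0"
    using orth_proj_linear_exists[OF subS] by metis
  have AT: "A *v (T x) = A *v x" for x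
  proof -
    have "(A *v (x - T x)) \<bullet> y = 0" for y
      using T(4)[of "transpose A *v y" x] by (simp add: inner_transpose_mult S_def)
    then have "A *v (x - T x) = 0" by (metis inner_eq_zero_iff)
    then show ?thesis by (simp add: matrix_vector_mult_diff_distrib)
  qed
  have inj: "inj_on ((*v) A) S"
  proof (rule inj_onI)
    fix x y assume xy: "x \<in> S" "y \<in> S" "A *v x = A *v y"
    then obtain z where z: "x - y = transpose A *v z"
      using subspace_diff[OF subS, of x y] by (auto simp: S_def)
    have "(x - y) \<bullet> (x - y) = (A *v (x - y)) \<bullet> z"
      by (metis inner_transpose_mult z)
    also have "\<dots> = 0" using xy by (simp add: matrix_vector_mult_diff_distrib)
    finally show "x = y" by simp
  qed
  obtain g where g: "range g \<subseteq> S" "linear g" "\<And>v. v \<in> S \<Longrightarrow> g (A *v v) = v"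
    using linear_exists_left_inverse_on[OF matrix_vector_mul_linear subS inj] by blast
  have gA: "g (A *v x) = T x" for x
    by (metis AT T(2) g(3))
  define B where "B = matrix (g \<circ> P)"
  have B: "B *v x = g (P x)" for x
    unfolding B_def using linear_compose[OF P(1) g(2)] by (simp add: matrix_works)
  have AB: "A *v (B *v x) = P x" for x
  proof -
    obtain v where "P x = A *v v" using P(2)[of x] by (auto simp: R_def)
    then show ?thesis by (simp add: B gA AT)
  qed
  have BA: "B *v (A *v x) = T x" for x
    using P(3)[of "A *v x"] by (simp add: B gA R_def)
  have symP: "P x \<bullet> y = x \<bullet> P y" for x y
    using P(4)[of "P y" x] P(4)[of "P x" y] P(2)
    by (simp add: inner_diff_left) (metis inner_commute)
  have symT: "T x \<bullet> y = x \<bullet> T y" for x y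
    using T(4)[of "T y" x] T(4)[of "T x" y] T(2)
    by (simp add: inner_diff_left) (metis inner_commute)
  have "moore_penrose A B"
    unfolding moore_penrose_def
  proof (intro conjI symmetric_matrixI)
    show "A ** B ** A = A"
      using P(3) by (auto simp: matrix_eq AB R_def simp flip: matrix_vector_mul_assoc)
    have "B *v (A *v (B *v x)) = B *v x" for x
      unfolding AB by (simp add: B P(3)[OF P(2)])
    then show "B ** A ** B = B"
      by (simp add: matrix_eq flip: matrix_vector_mul_assoc)
  qed (simp_all add: AB BA symP symT flip: matrix_vector_mul_assoc)
  then show ?thesis ..
qed

lemma moore_penrose_pinv: "moore_penrose A (pinv A)"
  unfolding pinv_def using moore_penrose_exists[of A] moore_penrose_unique
  by (metis (no_types, lifting) theI)

text \<open>\<open>proj_mat X J\<close> is the orthogonal projection onto the span of the columns indexed by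
  \<open>J\<close>.\<close>

lemma gram_cancel:
  fixes X :: "real^'p^'n" and M :: "real^'p^'p"
  assumes "transpose X ** X ** M = transpose X ** X"
  shows "X ** M = X"
proof -
  have "(X ** M) *v v = X *v v" for v
  proof -
    define w where "w = M *v v - v"
    have "transpose X *v (X *v w) = 0"
      using assms unfolding w_def
      by (simp add: matrix_vector_mult_diff_distrib matrix_vector_mul_assoc matrix_mul_assoc)
    then have "(X *v w) \<bullet> (X *v w) = 0"
      by (simp add: inner_transpose_mult)
    then show ?thesis
      by (simp add: w_def matrix_vector_mult_diff_distrib flip: matrix_vector_mul_assoc)
  qed
  then show ?thesis by (simp add: matrix_eq)
qed

lemma range_restrict_cols:
  fixes X :: "real^'p^'n"
  shows "range ((*v) (restrict_cols X J)) = span ((\<lambda>j. column j X) ` J)"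
proof
  have col: "column j (restrict_cols X J) = (if j \<in> J then column j X else 0)" for j
    by (auto simp: column_def restrict_cols_def vec_eq_iff)
  show "range ((*v) (restrict_cols X J)) \<subseteq> span ((\<lambda>j. column j X) ` J)"
  proof (rule image_subsetI)
    fix b :: "real^'p"
    have "restrict_cols X J *v b = (\<Sum>j\<in>UNIV. b $ j *\<^sub>R (if j \<in> J then column j X else 0))"
      by (simp add: matrix_mult_sum col scalar_mult_eq_scaleR)
    also have "\<dots> \<in> span ((\<lambda>j. column j X) ` J)"
      by (intro span_sum span_scale) (auto intro: span_base span_zero)
    finally show "restrict_cols X J *v b \<in> span ((\<lambda>j. column j X) ` J)" .
  qed
  have "column j X \<in> range ((*v) (restrict_cols X J))" if "j \<in> J" for j
  proof -
    have "column j X = restrict_cols X J *v axis j 1"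
      using that by (simp add: matrix_vector_mult_basis col)
    then show ?thesis by blast
  qed
  moreover have "subspace (range ((*v) (restrict_cols X J)))"
    by (intro linear_subspace_image) auto
  ultimately show "span ((\<lambda>j. column j X) ` J) \<subseteq> range ((*v) (restrict_cols X J))"
    by (intro span_minimal) auto
qed

lemma proj_mat_orthogonal_projection:
  fixes X :: "real^'p^'n"
  shows "proj_mat X J *v y \<in> span ((\<lambda>j. column j X) ` J)"
    and "s \<in> span ((\<lambda>j. column j X) ` J) \<Longrightarrow> (y - proj_mat X J *v y) \<bullet> s = 0"
proof -
  define Z where "Z = restrict_cols X J"
  define G where "G = transpose Z ** Z"
  define H where "H = pinv G"
  have A: "proj_mat X J = Z ** H ** transpose Z"
    by (simp add: proj_mat_def Let_def Z_def G_def H_def)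
  show "proj_mat X J *v y \<in> span ((\<lambda>j. column j X) ` J)"
    unfolding A range_restrict_cols[symmetric]
    by (simp add: Z_def flip: matrix_vector_mul_assoc)
  have Gt: "transpose G = G"
    by (simp add: G_def matrix_transpose_mul)
  have GHG: "G ** H ** G = G"
    using moore_penrose_pinv[of G] by (simp add: H_def moore_penrose_def)
  have "G ** (transpose H ** G) = G"
    using arg_cong[OF GHG, of transpose] by (simp add: matrix_transpose_mul Gt)
  then have "Z ** (transpose H ** G) = Z"
    using gram_cancel[of Z "transpose H ** G"] by (simp add: G_def)
  from arg_cong[OF this, of transpose]
  have ZG: "G ** H ** transpose Z = transpose Z"
    by (simp add: matrix_transpose_mul Gt)
  assume "s \<in> span ((\<lambda>j. column j X) ` J)"
  then obtain b where b: "s = Z *v b"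
    by (auto simp: Z_def range_restrict_cols[symmetric])
  have "transpose Z *v (proj_mat X J *v y) = (G ** H ** transpose Z) *v y"
    by (simp add: A G_def matrix_vector_mul_assoc matrix_mul_assoc)
  also have "\<dots> = transpose Z *v y" by (simp add: ZG)
  finally have "transpose Z *v (y - proj_mat X J *v y) = 0"
    by (simp add: matrix_vector_mult_diff_distrib)
  then show "(y - proj_mat X J *v y) \<bullet> s = 0"
    unfolding b by (metis inner_commute inner_transpose_mult inner_zero_right)
qed

lemma prior_weight_pos: "prior_weight (J :: 'p::finite set) > 0"
  unfolding prior_weight_def by (simp add: card_mono zero_less_binomial)

lemma sparsity_prior_pos: "sparsity_prior $ J > 0"
  unfolding sparsity_prior_def by (simp add: prior_weight_pos sum_pos)

lemma sparsity_prior_prob: "sparsity_prior \<in> prob_vectors"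
proof -
  have "(\<Sum>K\<in>UNIV. prior_weight (K :: 'a set)) > 0"
    by (simp add: prior_weight_pos sum_pos)
  then show ?thesis
    unfolding prob_vectors_def
    by (auto simp: less_imp_le[OF sparsity_prior_pos])
       (simp add: sparsity_prior_def flip: sum_divide_distrib)
qed

lemma compact_prob_vectors: "compact (prob_vectors :: (real^'k) set)"
proof -
  have eq: "(prob_vectors :: (real^'k) set) =
      {\<theta>. \<forall>k. 0 \<le> \<theta> $ k} \<inter> {\<theta>. (\<Sum>k\<in>UNIV. \<theta> $ k) = 1}"
    by (auto simp: prob_vectors_def)
  have "closed (prob_vectors :: (real^'k) set)"
    unfolding eq by (intro closed_Int closed_Collect_all closed_Collect_le closed_Collect_eq
        continuous_intros)
  moreover have "norm \<theta> \<le> 1" if "\<theta> \<in> prob_vectors" for \<theta> :: "real^'k"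
    using norm_le_l1_cart[of \<theta>] that by (simp add: prob_vectors_def)
  ultimately show ?thesis
    using compact_eq_bounded_closed boundedI by metis
qed

lemma continuous_on_x_ln_div:
  fixes c :: real
  assumes "c > 0"
  shows "continuous_on {0..} (\<lambda>x. x * ln (x / c))"
proof -
  have "((\<lambda>x::real. x * ln (x / c)) \<longlongrightarrow> 0) (at_right 0)"
    using assms by real_asymp
  then have "continuous (at 0 within {0..}) (\<lambda>x. x * ln (x / c))"
    by (simp add: continuous_within at_within_Ici_at_right)
  moreover have "continuous (at x within {0..}) (\<lambda>x. x * ln (x / c))" if "x > 0" for x
    using that assms by (intro continuous_intros) auto
  ultimately show ?thesis
    unfolding continuous_on_eq_continuous_within by (metis atLeast_iff order_le_less)
qed

lemma Q_minimizer_exists: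
  "\<exists>\<theta>. is_arg_min (Q_fun X \<sigma> \<nu> lam y) (\<lambda>\<theta>. \<theta> \<in> prob_vectors) \<theta>"
proof -
  have "continuous_on prob_vectors (\<lambda>\<theta> :: real^('a set).
      \<theta> $ J * ln (\<theta> $ J / sparsity_prior $ J))" for J
    by (rule continuous_on_compose2[OF continuous_on_x_ln_div[OF sparsity_prior_pos]])
       (auto intro!: continuous_intros simp: prob_vectors_def)
  then have "continuous_on prob_vectors (\<lambda>\<theta> :: real^('a set). KL \<theta> sparsity_prior)"
    unfolding KL_def by (intro continuous_on_sum)
  then have "continuous_on prob_vectors (Q_fun X \<sigma> \<nu> lam y)"
    unfolding Q_fun_def mix_def
    by (intro continuous_on_add continuous_on_mult continuous_on_const continuous_on_sum
        continuous_on_power continuous_on_norm continuous_on_diff continuous_on_scaleR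
        continuous_on_component continuous_on_id) auto
  then show ?thesis
    using continuous_attains_inf[OF compact_prob_vectors, of "Q_fun X \<sigma> \<nu> lam y"]
      sparsity_prior_prob by (auto simp: is_arg_min_def not_less)
qed

lemma Q_aggregate_exists: "\<exists>muhat. is_Q_aggregate X \<sigma> \<nu> lam muhat"
proof -
  obtain th where "\<And>y. is_arg_min (Q_fun X \<sigma> \<nu> lam y) (\<lambda>\<theta>. \<theta> \<in> prob_vectors) (th y)"
    using Q_minimizer_exists[of X \<sigma> \<nu> lam] by metis
  then have "is_Q_aggregate X \<sigma> \<nu> lam (\<lambda>y. mix X y (th y))"
    unfolding is_Q_aggregate_def by blast
  then show ?thesis by blast
qed

lemma phi_nonneg: "phi q \<beta> \<tau> B \<delta> \<ge> 0"
  by (simp add: phi_def Let_def logbar_def le_max_iff_disj)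

end

theory Submission
  imports Defs
begin

text \<open>Both aggregates are compared with one fixed least squares estimator \<open>f\<^sub>K\<close>, where \<open>f\<^sub>J = A\<^sub>J Y\<close>. The noise
enters through the loss of \<open>f\<^sub>K\<close>, which exceeds \<open>\<parallel>A\<^sub>K \<mu> - \<mu>\<parallel>\<^sup>2\<close> by \<open>\<parallel>A\<^sub>K \<xi>\<parallel>\<^sup>2 \<le> \<parallel>A\<^bsub>J\<union>K\<^esub> \<xi>\<parallel>\<^sup>2\<close>, and
through the cross terms \<open>2 \<langle>\<xi>, f\<^sub>J - f\<^sub>K\<rangle>\<close>. Since \<open>f\<^sub>J - f\<^sub>K\<close> lies in the span of the columns indexed by
\<open>J \<union> K\<close>, a cross term is at most \<open>a \<parallel>A\<^bsub>J\<union>K\<^esub> \<xi>\<parallel>\<^sup>2 + \<parallel>f\<^sub>J - f\<^sub>K\<parallel>\<^sup>2 / a\<close> for every \<open>a > 0\<close>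
(\<open>inner_least_squares_diff_le\<close>). For the \<open>Q\<close>-aggregate, the strong convexity of the criterion
(\<open>Q_fun_strong_convexity\<close>) together with the variance of the estimators under the weights produces exactly
\<open>- 1/2 \<Sum>\<^sub>J \<theta>\<^sub>J \<parallel>f\<^sub>J - f\<^sub>K\<parallel>\<^sup>2\<close>, so that \<open>a = 2\<close> leaves the leading constant at \<open>1\<close>. Exponential weights
provide no such term; with \<open>a = 8\<close> the quadratic part is absorbed into a quarter of the losses on both sides, which gives
the factor \<open>(1 + 1/4) / (1 - 1/4) = 5/3\<close>.

What remains is an average over \<open>J\<close> of the chi-squared variables \<open>\<parallel>A\<^bsub>J\<union>K\<^esub> \<xi>\<parallel>\<^sup>2\<close> under random weights
\<open>\<theta>\<close>. The entropy penalty turns it into the logarithm of a prior average of exponentials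
(\<open>KL_variational\<close>), whose expectation is finite uniformly in the design, because the factor
\<open>e\<^bsup>-|J|\<^esup>\<close> of the prior beats the exponential moment \<open>e\<^bsup>(|J|+|K|)/5\<^esup>\<close> of a chi-squared variable with
at most \<open>|J| + |K|\<close> degrees of freedom. A single application of Markov's inequality (\<open>prob_low_noise\<close>) then gives both
parts: up to the leading constant, the loss of the aggregate is at most \<open>\<parallel>A\<^sub>K \<mu> - \<mu>\<parallel>\<^sup>2 + (\<tau>\<^sup>2/4) c\<^sub>K\<close>, where
the complexity \<open>c\<^sub>K\<close> is of order \<open>|K| log (e p / |K|) + log (2 / \<delta>)\<close>.

This bound is deterministic, so it suffices to use it for a set \<open>K\<close> that minimizes it, and to show that
the minimum is below \<open>\<parallel>X \<beta> - \<mu>\<parallel>\<^sup>2 + \<phi>\<close> for all \<open>q\<close> and \<open>\<beta>\<close> (\<open>sparsity_oracle\<close>). For \<open>q = 0\<close> one takes the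
support of \<open>\<beta>\<close>. For \<open>q > 0\<close> the coefficients below a threshold \<open>t\<close> are rounded to \<open>0\<close> or \<open>\<plusminus>t\<close>. If this is
done at random without bias, then the error \<open>\<parallel>X \<beta> - \<mu>\<parallel>\<^sup>2\<close> increases in the mean only by a variance of
order \<open>B\<^sup>2 t\<^sup>2 |\<beta>|\<^sub>q\<^sup>q / t\<^sup>q\<close>, and the mean size of the support is at most \<open>|\<beta>|\<^sub>q\<^sup>q / t\<^sup>q\<close>; hence some rounding does at
least as well (\<open>sparse_approximation\<close>). The remainder \<open>\<phi>\<close> results from the threshold that balances variance
against complexity.

Finally, both estimators are continuous in the observation, which makes the events measurable.\<close>

section \<open>Projections onto spans of columns\<close>

lemma proj_mat_eqI:
  fixes X :: "real^'p^'n"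
  assumes "v \<in> span ((\<lambda>j. column j X) ` J)"
    and "\<And>s. s \<in> span ((\<lambda>j. column j X) ` J) \<Longrightarrow> (y - v) \<bullet> s = 0"
  shows "proj_mat X J *v y = v"
proof -
  let ?V = "span ((\<lambda>j. column j X) ` J)" and ?d = "proj_mat X J *v y - v"
  have d: "?d \<in> ?V"
    by (rule span_diff[OF proj_mat_orthogonal_projection(1) assms(1)])
  have "?d \<bullet> ?d = (y - v) \<bullet> ?d - (y - proj_mat X J *v y) \<bullet> ?d"
    by (simp add: inner_diff_left)
  also have "\<dots> = 0"
    using assms(2)[OF d] proj_mat_orthogonal_projection(2)[OF d] by simp
  finally show ?thesis by simp
qed

lemma proj_mat_pythagoras:
  fixes X :: "real^'p^'n"
  assumes "v \<in> span ((\<lambda>j. column j X) ` J)"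
  shows "(norm (y - v))\<^sup>2 = (norm (y - proj_mat X J *v y))\<^sup>2 + (norm (proj_mat X J *v y - v))\<^sup>2"
proof -
  have "(y - proj_mat X J *v y) \<bullet> (proj_mat X J *v y - v) = 0"
    using assms by (intro proj_mat_orthogonal_projection(2) span_diff proj_mat_orthogonal_projection(1))
  then have "norm (y - proj_mat X J *v y + (proj_mat X J *v y - v)) ^ 2
      = (norm (y - proj_mat X J *v y))\<^sup>2 + (norm (proj_mat X J *v y - v))\<^sup>2"
    by (intro norm_add_Pythagorean) (simp add: orthogonal_def)
  then show ?thesis by simp
qed

lemma norm_proj_mat_residual_le: "norm (y - proj_mat X J *v y) \<le> norm y"
  by (rule power2_le_imp_le) (use proj_mat_pythagoras[OF span_zero, of y X J] in simp_all)

lemma norm_proj_mat_le: "norm (proj_mat X J *v y) \<le> norm y"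
  by (rule power2_le_imp_le) (use proj_mat_pythagoras[OF span_zero, of y X J] in simp_all)

lemma inner_proj_mat:
  fixes X :: "real^'p^'n"
  assumes "v \<in> span ((\<lambda>j. column j X) ` J)"
  shows "y \<bullet> v = (proj_mat X J *v y) \<bullet> v"
  using proj_mat_orthogonal_projection(2)[OF assms, of y] by (simp add: inner_diff_left)

lemma norm_proj_mat_mono:
  fixes X :: "real^'p^'n"
  assumes "J \<subseteq> K"
  shows "norm (proj_mat X J *v y) \<le> norm (proj_mat X K *v y)"
proof -
  let ?u = "proj_mat X J *v y" and ?w = "proj_mat X K *v y"
  have J: "?u \<in> span ((\<lambda>j. column j X) ` J)"
    by (rule proj_mat_orthogonal_projection(1))
  then have K: "?u \<in> span ((\<lambda>j. column j X) ` K)"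
    using span_mono[OF image_mono[OF assms]] by blast
  have "norm ?u * norm ?u = ?u \<bullet> ?u" by (simp add: norm_eq_sqrt_inner)
  also have "\<dots> = ?w \<bullet> ?u" using inner_proj_mat[OF J, of y] inner_proj_mat[OF K, of y] by simp
  also have "\<dots> \<le> norm ?w * norm ?u" by (rule norm_cauchy_schwarz)
  finally show ?thesis by (cases "?u = 0") auto
qed

lemma mult_vec_in_span_columns:
  fixes X :: "real^'p^'n"
  assumes "{j. \<beta> $ j \<noteq> 0} \<subseteq> J"
  shows "X *v \<beta> \<in> span ((\<lambda>j. column j X) ` J)"
proof -
  have "X *v \<beta> = (\<Sum>j\<in>UNIV. \<beta> $ j *\<^sub>R column j X)"
    by (simp add: matrix_mult_sum scalar_mult_eq_scaleR)
  also have "\<dots> \<in> span ((\<lambda>j. column j X) ` J)"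
  proof (intro span_sum)
    fix j show "\<beta> $ j *\<^sub>R column j X \<in> span ((\<lambda>j. column j X) ` J)"
      using assms by (cases "\<beta> $ j = 0") (auto intro: span_scale span_base span_zero)
  qed
  finally show ?thesis .
qed

text \<open>An orthonormal basis of the column span turns \<open>\<parallel>A\<^sub>J \<xi>\<parallel>\<^sup>2\<close> into a sum of at most \<open>|J|\<close> squares of
coordinates, and the trace of \<open>A\<^sub>J\<close> into the number of basis vectors.\<close>

lemma proj_mat_orthonormal_basis:
  fixes X :: "real^'p^'n"
  obtains B where "finite B" "card B \<le> card J" "pairwise orthogonal B" "\<And>b. b \<in> B \<Longrightarrow> norm b = 1"
    "\<And>y. proj_mat X J *v y = (\<Sum>b\<in>B. (y \<bullet> b) *\<^sub>R b)"
proof -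
  let ?V = "span ((\<lambda>j. column j X) ` J)"
  obtain B where B: "B \<subseteq> ?V" "pairwise orthogonal B" "\<And>x. x \<in> B \<Longrightarrow> norm x = 1"
      "independent B" "card B = dim ?V" "span B = ?V"
    using orthonormal_basis_subspace[OF subspace_span] by metis
  have fB: "finite B" using B(4) independent_imp_finite by blast
  have "dim ?V \<le> card ((\<lambda>j. column j X) ` J)"
    by (simp add: dim_le_card')
  also have "\<dots> \<le> card J" by (rule card_image_le) simp
  finally have cB: "card B \<le> card J" using B(5) by simp
  have "proj_mat X J *v y = (\<Sum>b\<in>B. (y \<bullet> b) *\<^sub>R b)" for y
  proof (rule proj_mat_eqI)
    show "(\<Sum>b\<in>B. (y \<bullet> b) *\<^sub>R b) \<in> ?V"
      using B(1) by (intro span_sum span_scale) auto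
    fix s assume "s \<in> ?V"
    then have s: "s \<in> span B" using B(6) by simp
    have "orthogonal (y - (\<Sum>b\<in>B. (y \<bullet> b) *\<^sub>R b)) c" if c: "c \<in> B" for c
    proof -
      have "(\<Sum>b\<in>B. (y \<bullet> b) * (b \<bullet> c)) = (\<Sum>b\<in>B. if b = c then y \<bullet> c else 0)"
        using B(2,3) c by (intro sum.cong) (auto simp: pairwise_def orthogonal_def dot_square_norm)
      then show ?thesis
        using c fB by (simp add: orthogonal_def inner_diff_left inner_sum_left)
    qed
    then show "(y - (\<Sum>b\<in>B. (y \<bullet> b) *\<^sub>R b)) \<bullet> s = 0"
      using orthogonal_to_span[OF s] by (simp add: orthogonal_def)
  qed
  then show ?thesis using that fB cB B(2,3) by blast
qed

lemma trace_proj_mat: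
  fixes X :: "real^'p^'n"
  shows "0 \<le> trace (proj_mat X J)" and "trace (proj_mat X J) \<le> card J"
proof -
  obtain B where B: "finite B" "card B \<le> card J" "pairwise orthogonal B"
      "\<And>b. b \<in> B \<Longrightarrow> norm b = 1" "\<And>y. proj_mat X J *v y = (\<Sum>b\<in>B. (y \<bullet> b) *\<^sub>R b)"
    by (rule proj_mat_orthonormal_basis[of J X]) (rule that)
  have "proj_mat X J $ i $ i = (\<Sum>b\<in>B. (b $ i)\<^sup>2)" for i
  proof -
    have "proj_mat X J $ i $ i = (proj_mat X J *v axis i 1) $ i"
      by (simp add: matrix_vector_mult_basis column_def)
    also have "\<dots> = (\<Sum>b\<in>B. (axis i 1 \<bullet> b) * b $ i)"
      unfolding B(5) by simp
    also have "\<dots> = (\<Sum>b\<in>B. (b $ i)\<^sup>2)"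
      by (simp add: inner_axis' power2_eq_square)
    finally show ?thesis .
  qed
  then have "trace (proj_mat X J) = (\<Sum>i\<in>UNIV. \<Sum>b\<in>B. (b $ i)\<^sup>2)"
    by (simp add: trace_def)
  also have "\<dots> = (\<Sum>b\<in>B. \<Sum>i\<in>UNIV. (b $ i)\<^sup>2)"
    by (rule sum.swap)
  also have "\<dots> = (\<Sum>b\<in>B. (norm b)\<^sup>2)"
    by (simp add: norm_vec_def L2_set_def sum_nonneg)
  also have "\<dots> = card B" using B(4) by simp
  finally show "0 \<le> trace (proj_mat X J)" "trace (proj_mat X J) \<le> card J" using B(2) by auto
qed

lemma C_pen_bounds:
  fixes X :: "real^'p^'n"
  shows "0 \<le> C_pen X \<sigma> J" and "C_pen X \<sigma> J \<le> 4 * \<sigma>\<^sup>2 * card J"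
  unfolding C_pen_def by (intro mult_nonneg_nonneg mult_left_mono trace_proj_mat; simp)+

text \<open>The bias of a projection estimator is orthogonal to its stochastic part.\<close>

lemma norm_least_squares_error:
  fixes X :: "real^'p^'n"
  shows "(norm (least_squares X J (\<mu> + x) - \<mu>))\<^sup>2
    = (norm (proj_mat X J *v \<mu> - \<mu>))\<^sup>2 + (norm (proj_mat X J *v x))\<^sup>2"
  using proj_mat_pythagoras[OF proj_mat_orthogonal_projection(1), of \<mu> X J "\<mu> + x"]
  by (simp add: least_squares_def matrix_vector_right_distrib norm_minus_commute)

text \<open>Only the part of the noise in the span of the columns in \<open>J \<union> K\<close> sees the difference of the two
estimators. The free constant \<open>a\<close> decides how the product is split.\<close>

lemma inner_least_squares_diff_le:
  fixes X :: "real^'p^'n"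
  assumes "a > 0"
  shows "2 * (x \<bullet> (least_squares X J y - least_squares X K y))
    \<le> a * (norm (proj_mat X (J \<union> K) *v x))\<^sup>2
      + (norm (least_squares X J y - least_squares X K y))\<^sup>2 / a"
proof -
  let ?d = "least_squares X J y - least_squares X K y" and ?u = "proj_mat X (J \<union> K) *v x"
  have "?d \<in> span ((\<lambda>j. column j X) ` (J \<union> K))"
    unfolding least_squares_def
    by (intro span_diff subsetD[OF span_mono proj_mat_orthogonal_projection(1)]) auto
  from inner_proj_mat[OF this] have "x \<bullet> ?d = ?u \<bullet> ?d" .
  also have "\<dots> \<le> norm ?u * norm ?d" by (rule norm_cauchy_schwarz)
  finally have 1: "x \<bullet> ?d \<le> norm ?u * norm ?d" .
  have "0 \<le> (a * norm ?u - norm ?d)\<^sup>2 / a" using assms by simp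
  also have "\<dots> = a * (norm ?u)\<^sup>2 + (norm ?d)\<^sup>2 / a - 2 * (norm ?u * norm ?d)"
    using assms by (simp add: power2_eq_square field_simps)
  finally show ?thesis using 1 by linarith
qed

section \<open>Exponential moments of squared Gaussian projections\<close>

lemma nn_integral_normal_density:
  assumes "0 < \<sigma>"
  shows "(\<integral>\<^sup>+x. ennreal (normal_density m \<sigma> x) \<partial>lborel) = 1"
  by (subst nn_integral_eq_integral) (use assms in auto)

lemma normal_mgf:
  assumes "0 < \<sigma>"
  shows "(\<integral>\<^sup>+x. ennreal (normal_density 0 \<sigma> x * exp (c * x)) \<partial>lborel) = ennreal (exp (\<sigma>\<^sup>2 * c\<^sup>2 / 2))"
proof -
  have "normal_density 0 \<sigma> x * exp (c * x) = exp (\<sigma>\<^sup>2 * c\<^sup>2 / 2) * normal_density (\<sigma>\<^sup>2 * c) \<sigma> x" for x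
    using assms unfolding normal_density_def
    by (simp add: field_simps power2_eq_square flip: exp_add)
  then show ?thesis
    using assms by (simp add: ennreal_mult nn_integral_cmult nn_integral_normal_density)
qed

lemma normal_square_mgf:
  assumes "0 \<le> a" "a < 1/2"
  shows "(\<integral>\<^sup>+z. ennreal (std_normal_density z * exp (a * z\<^sup>2)) \<partial>lborel) = ennreal (1 / sqrt (1 - 2 * a))"
proof -
  define r where "r = sqrt (1 - 2 * a)"
  have r: "r > 0" "r\<^sup>2 = 1 - 2 * a" using assms by (auto simp: r_def)
  have "std_normal_density z * exp (a * z\<^sup>2) = (1 / r) * normal_density 0 (1 / r) z" for z
  proof -
    have "- z\<^sup>2 / 2 + a * z\<^sup>2 = - (z\<^sup>2 * r\<^sup>2) / 2" unfolding r(2) by (simp add: algebra_simps)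
    then show ?thesis
      using r(1) by (simp add: normal_density_def real_sqrt_mult real_sqrt_divide power_divide
          mult.commute flip: exp_add)
  qed
  then have "(\<integral>\<^sup>+z. ennreal (std_normal_density z * exp (a * z\<^sup>2)) \<partial>lborel)
      = (\<integral>\<^sup>+z. ennreal (1 / r) * ennreal (normal_density 0 (1 / r) z) \<partial>lborel)"
    using r(1) by (simp flip: ennreal_mult)
  also have "\<dots> = ennreal (1 / r)"
    using r(1) by (simp add: nn_integral_cmult nn_integral_normal_density)
  finally show ?thesis by (simp add: r_def)
qed

lemma gaussian_mgf:
  fixes \<xi> :: "'a \<Rightarrow> real^'n"
  assumes "distributed M lborel \<xi> (\<lambda>x. ennreal (\<Prod>i\<in>UNIV. normal_density 0 \<sigma> (x $ i)))" "0 < \<sigma>"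
  shows "(\<integral>\<^sup>+\<omega>. ennreal (exp (c \<bullet> \<xi> \<omega>)) \<partial>M) = ennreal (exp (\<sigma>\<^sup>2 * (norm c)\<^sup>2 / 2))"
proof -
  have B: "(Basis :: (real^'n) set) = (\<lambda>i. axis i 1) ` UNIV"
    by (auto simp: Basis_vec_def)
  have inj: "inj (\<lambda>i::'n. axis i (1::real))"
    by (auto simp: inj_on_def axis_eq_axis)
  have "(\<integral>\<^sup>+\<omega>. ennreal (exp (c \<bullet> \<xi> \<omega>)) \<partial>M)
      = (\<integral>\<^sup>+x. ennreal (\<Prod>i\<in>UNIV. normal_density 0 \<sigma> (x $ i)) * ennreal (exp (c \<bullet> x)) \<partial>lborel)"
    by (rule distributed_nn_integral[OF assms(1), symmetric]) simp
  also have "\<dots> = (\<integral>\<^sup>+x. (\<Prod>b\<in>Basis. ennreal (normal_density 0 \<sigma> (x \<bullet> b) * exp ((c \<bullet> b) * (x \<bullet> b)))) \<partial>lborel)"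
  proof (intro nn_integral_cong)
    fix x :: "real^'n"
    have "(\<Prod>i\<in>UNIV. normal_density 0 \<sigma> (x $ i)) * exp (c \<bullet> x)
        = (\<Prod>i\<in>UNIV. normal_density 0 \<sigma> (x $ i) * exp (c $ i * x $ i))"
      by (simp add: prod.distrib inner_vec_def exp_sum)
    also have "\<dots> = (\<Prod>b\<in>Basis. normal_density 0 \<sigma> (x \<bullet> b) * exp ((c \<bullet> b) * (x \<bullet> b)))"
      unfolding B by (subst prod.reindex[OF inj]) (simp add: inner_axis)
    finally show "ennreal (\<Prod>i\<in>UNIV. normal_density 0 \<sigma> (x $ i)) * ennreal (exp (c \<bullet> x))
        = (\<Prod>b\<in>Basis. ennreal (normal_density 0 \<sigma> (x \<bullet> b) * exp ((c \<bullet> b) * (x \<bullet> b))))"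
      by (simp add: ennreal_mult[symmetric] prod_nonneg prod_ennreal)
  qed
  also have "\<dots> = (\<Prod>b\<in>Basis. ennreal (exp (\<sigma>\<^sup>2 * (c \<bullet> b)\<^sup>2 / 2)))"
    by (subst nn_integral_lborel_prod) (simp_all add: normal_mgf[OF assms(2)])
  also have "\<dots> = ennreal (exp (\<sigma>\<^sup>2 * (\<Sum>b\<in>Basis. (c \<bullet> b)\<^sup>2) / 2))"
    by (simp add: prod_ennreal sum_distrib_left sum_divide_distrib flip: exp_sum)
  also have "(\<Sum>b\<in>Basis. (c \<bullet> b)\<^sup>2) = (norm c)\<^sup>2"
    unfolding power2_norm_eq_inner euclidean_inner[of c c] by (simp add: power2_eq_square)
  finally show ?thesis .
qed

text \<open>Each square is linearized by an auxiliary Gaussian variable \<open>z\<close>: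
\<open>exp (s u\<^sup>2)\<close> is the mean of \<open>exp (\<surd>(2 s) z u)\<close>. After exchanging the integrals, an induction over the
orthonormal set leaves only moment generating functions of linear functionals. The additional
linear term \<open>c\<close>, orthogonal to the set, carries the linearized coordinates through the induction, and
orthogonality makes their contributions multiply. This avoids rotating the coordinates.\<close>

lemma gaussian_orthonormal_square_mgf:
  fixes \<xi> :: "'a \<Rightarrow> real^'n"
  assumes "prob_space M"
    and \<xi>: "distributed M lborel \<xi> (\<lambda>x. ennreal (\<Prod>i\<in>UNIV. normal_density 0 \<sigma> (x $ i)))" "0 < \<sigma>"
    and s: "0 \<le> s" "2 * s * \<sigma>\<^sup>2 < 1"
    and B: "finite B" "pairwise orthogonal B" "\<And>b. b \<in> B \<Longrightarrow> norm b = 1"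
    and c: "\<And>b. b \<in> B \<Longrightarrow> c \<bullet> b = 0"
  shows "(\<integral>\<^sup>+\<omega>. ennreal (exp (s * (\<Sum>b\<in>B. (\<xi> \<omega> \<bullet> b)\<^sup>2) + c \<bullet> \<xi> \<omega>)) \<partial>M)
    = ennreal ((1 / sqrt (1 - 2 * s * \<sigma>\<^sup>2)) ^ card B * exp (\<sigma>\<^sup>2 * (norm c)\<^sup>2 / 2))"
  using B c
proof (induction B arbitrary: c rule: finite_induct)
  case empty
  then show ?case using gaussian_mgf[OF \<xi>] by simp
next
  case (insert e F)
  interpret prob_space M by fact
  interpret pair_sigma_finite M "lborel :: real measure" ..
  have [measurable]: "\<xi> \<in> borel_measurable M"
    using distributed_measurable[OF \<xi>(1)] by simp
  define k where "k = 1 / sqrt (1 - 2 * s * \<sigma>\<^sup>2)"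
  define S where "S \<omega> = s * (\<Sum>b\<in>F. (\<xi> \<omega> \<bullet> b)\<^sup>2) + c \<bullet> \<xi> \<omega>" for \<omega>
  have [measurable]: "S \<in> borel_measurable M" unfolding S_def by measurable
  have e: "norm e = 1" "c \<bullet> e = 0" "\<And>b. b \<in> F \<Longrightarrow> e \<bullet> b = 0"
    using insert.prems insert.hyps by (auto simp: pairwise_insert orthogonal_def)
  have hs: "ennreal (exp (s * (\<Sum>b\<in>insert e F. (\<xi> \<omega> \<bullet> b)\<^sup>2) + c \<bullet> \<xi> \<omega>))
      = (\<integral>\<^sup>+z. ennreal (std_normal_density z * exp (S \<omega> + z * (sqrt (2 * s) * (e \<bullet> \<xi> \<omega>)))) \<partial>lborel)" for \<omega>
  proof -
    have "(\<integral>\<^sup>+z. ennreal (std_normal_density z * exp (S \<omega> + z * (sqrt (2 * s) * (e \<bullet> \<xi> \<omega>)))) \<partial>lborel)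
       = (\<integral>\<^sup>+z. ennreal (exp (S \<omega>)) * ennreal (std_normal_density z * exp (sqrt (2 * s) * (e \<bullet> \<xi> \<omega>) * z)) \<partial>lborel)"
      by (intro nn_integral_cong) (simp add: ennreal_mult[symmetric] exp_add mult_ac)
    also have "\<dots> = ennreal (exp (S \<omega>)) * ennreal (exp ((sqrt (2 * s) * (e \<bullet> \<xi> \<omega>))\<^sup>2 / 2))"
      by (simp add: nn_integral_cmult normal_mgf)
    also have "\<dots> = ennreal (exp (S \<omega> + s * (\<xi> \<omega> \<bullet> e)\<^sup>2))"
      using s(1) by (simp add: ennreal_mult[symmetric] power_mult_distrib inner_commute exp_add)
    finally show ?thesis
      using insert.hyps by (simp add: S_def algebra_simps)
  qed
  have inner: "(\<integral>\<^sup>+\<omega>. ennreal (std_normal_density z * exp (S \<omega> + z * (sqrt (2 * s) * (e \<bullet> \<xi> \<omega>)))) \<partial>M)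
      = ennreal (k ^ card F * exp (\<sigma>\<^sup>2 * (norm c)\<^sup>2 / 2)) * ennreal (std_normal_density z * exp (s * \<sigma>\<^sup>2 * z\<^sup>2))" for z
  proof -
    let ?c = "c + (z * sqrt (2 * s)) *\<^sub>R e"
    have n: "(norm ?c)\<^sup>2 = (norm c)\<^sup>2 + 2 * s * z\<^sup>2"
      using e s(1) norm_add_Pythagorean[of c "(z * sqrt (2 * s)) *\<^sub>R e"]
      by (simp add: orthogonal_def power_mult_distrib)
    have "(\<integral>\<^sup>+\<omega>. ennreal (std_normal_density z * exp (S \<omega> + z * (sqrt (2 * s) * (e \<bullet> \<xi> \<omega>)))) \<partial>M)
      = (\<integral>\<^sup>+\<omega>. ennreal (std_normal_density z) * ennreal (exp (s * (\<Sum>b\<in>F. (\<xi> \<omega> \<bullet> b)\<^sup>2) + ?c \<bullet> \<xi> \<omega>)) \<partial>M)"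
      by (intro nn_integral_cong) (simp add: ennreal_mult[symmetric] S_def inner_add_left algebra_simps)
    also have "\<dots> = ennreal (std_normal_density z) * (\<integral>\<^sup>+\<omega>. ennreal (exp (s * (\<Sum>b\<in>F. (\<xi> \<omega> \<bullet> b)\<^sup>2) + ?c \<bullet> \<xi> \<omega>)) \<partial>M)"
      by (intro nn_integral_cmult) measurable
    also have "(\<integral>\<^sup>+\<omega>. ennreal (exp (s * (\<Sum>b\<in>F. (\<xi> \<omega> \<bullet> b)\<^sup>2) + ?c \<bullet> \<xi> \<omega>)) \<partial>M)
        = ennreal (k ^ card F * exp (\<sigma>\<^sup>2 * (norm ?c)\<^sup>2 / 2))"
      unfolding k_def using insert.prems e
      by (intro insert.IH) (auto simp: pairwise_insert inner_add_left)
    finally show ?thesis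
      unfolding n using s(2)
      by (simp add: ennreal_mult[symmetric] k_def) (simp add: exp_add algebra_simps add_divide_distrib)
  qed
  have "(\<integral>\<^sup>+\<omega>. ennreal (exp (s * (\<Sum>b\<in>insert e F. (\<xi> \<omega> \<bullet> b)\<^sup>2) + c \<bullet> \<xi> \<omega>)) \<partial>M)
     = (\<integral>\<^sup>+\<omega>. \<integral>\<^sup>+z. ennreal (std_normal_density z * exp (S \<omega> + z * (sqrt (2 * s) * (e \<bullet> \<xi> \<omega>)))) \<partial>lborel \<partial>M)"
    by (simp add: hs)
  also have "\<dots> = (\<integral>\<^sup>+z. \<integral>\<^sup>+\<omega>. ennreal (std_normal_density z * exp (S \<omega> + z * (sqrt (2 * s) * (e \<bullet> \<xi> \<omega>)))) \<partial>M \<partial>lborel)"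
    by (rule Fubini'[symmetric]) measurable
  also have "\<dots> = ennreal (k ^ card F * exp (\<sigma>\<^sup>2 * (norm c)\<^sup>2 / 2)) * ennreal k"
    unfolding inner using s normal_square_mgf[of "s * \<sigma>\<^sup>2"] by (simp add: nn_integral_cmult k_def mult.assoc)
  also have "\<dots> = ennreal (k ^ card (insert e F) * exp (\<sigma>\<^sup>2 * (norm c)\<^sup>2 / 2))"
    using insert.hyps s(2) by (simp add: ennreal_mult[symmetric] k_def mult_ac)
  finally show ?case by (simp add: k_def)
qed

section \<open>Relative entropy and weighted averages\<close>

text \<open>The convex function \<open>x ln (x / c)\<close> lies above its tangent at \<open>m\<close>. Summing this over the coordinates
gives both the variational inequality and the convexity of the relative entropy.\<close>

lemma x_ln_div_tangent:
  fixes x m c :: real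
  assumes "0 \<le> x" "0 < m" "0 < c"
  shows "x * ln (m / c) + x - m \<le> x * ln (x / c)"
proof (cases "x = 0")
  case False
  then have x: "x > 0" using assms(1) by simp
  have "ln (m / x) \<le> m / x - 1" by (rule ln_le_minus_one) (use x assms in simp)
  then have "x * ln (m / x) \<le> x * (m / x - 1)" using x by (intro mult_left_mono) auto
  moreover have "x * (m / x - 1) = m - x" using x by (simp add: field_simps)
  moreover have "ln (m / x) = ln (m / c) - ln (x / c)" using x assms by (simp add: ln_div)
  ultimately show ?thesis by (simp add: algebra_simps)
qed (use assms in simp)

text \<open>This is the Gibbs (Donsker--Varadhan) inequality; the tangents are taken at the tilted prior
\<open>\<pi> e\<^sup>h / Z\<close>.\<close>

lemma KL_variational:
  fixes \<theta> \<pi> :: "real^'k" and h :: "'k \<Rightarrow> real"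
  assumes "\<theta> \<in> prob_vectors" "\<And>k. \<pi> $ k > 0" "(\<Sum>k\<in>UNIV. \<pi> $ k * exp (h k)) \<le> W"
  shows "(\<Sum>k\<in>UNIV. \<theta> $ k * h k) \<le> KL \<theta> \<pi> + ln W"
proof -
  define Z where "Z = (\<Sum>k\<in>UNIV. \<pi> $ k * exp (h k))"
  have Z: "Z > 0" unfolding Z_def using assms(2) by (intro sum_pos) auto
  have \<theta>: "\<And>k. 0 \<le> \<theta> $ k" "(\<Sum>k\<in>UNIV. \<theta> $ k) = 1"
    using assms(1) by (auto simp: prob_vectors_def)
  have "\<theta> $ k * (h k - ln Z) + \<theta> $ k - \<pi> $ k * exp (h k) / Z \<le> \<theta> $ k * ln (\<theta> $ k / \<pi> $ k)" for k
  proof -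
    have "ln (\<pi> $ k * exp (h k) / Z / \<pi> $ k) = h k - ln Z"
      using assms(2)[of k] Z by (simp add: ln_div)
    then show ?thesis
      using x_ln_div_tangent[OF \<theta>(1)[of k], of "\<pi> $ k * exp (h k) / Z" "\<pi> $ k"] assms(2)[of k] Z
      by simp
  qed
  then have "(\<Sum>k\<in>UNIV. \<theta> $ k * (h k - ln Z) + \<theta> $ k - \<pi> $ k * exp (h k) / Z) \<le> KL \<theta> \<pi>"
    unfolding KL_def by (intro sum_mono)
  moreover have "(\<Sum>k\<in>UNIV. \<theta> $ k * (h k - ln Z) + \<theta> $ k - \<pi> $ k * exp (h k) / Z)
      = (\<Sum>k\<in>UNIV. \<theta> $ k * h k) - ln Z"
    using \<theta>(2) Z
    by (simp add: sum.distrib sum_subtractf right_diff_distrib Z_def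
        flip: sum_divide_distrib sum_distrib_right)
  moreover have "ln Z \<le> ln W"
    using assms(3) Z by (simp flip: Z_def)
  ultimately show ?thesis by linarith
qed

lemma KL_convex:
  fixes \<theta> \<theta>' \<pi> :: "real^'k"
  assumes "\<theta> \<in> prob_vectors" "\<theta>' \<in> prob_vectors" "\<And>k. \<pi> $ k > 0" "0 < t" "t < 1"
  shows "KL ((1 - t) *\<^sub>R \<theta> + t *\<^sub>R \<theta>') \<pi> \<le> (1 - t) * KL \<theta> \<pi> + t * KL \<theta>' \<pi>"
proof -
  have "((1 - t) *\<^sub>R \<theta> + t *\<^sub>R \<theta>') $ k * ln (((1 - t) *\<^sub>R \<theta> + t *\<^sub>R \<theta>') $ k / \<pi> $ k)
     \<le> (1 - t) * (\<theta> $ k * ln (\<theta> $ k / \<pi> $ k)) + t * (\<theta>' $ k * ln (\<theta>' $ k / \<pi> $ k))" for k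
  proof -
    define a b m where "a = \<theta> $ k" and "b = \<theta>' $ k" and "m = (1 - t) * a + t * b"
    have ab: "a \<ge> 0" "b \<ge> 0" using assms(1,2) by (auto simp: a_def b_def prob_vectors_def)
    show ?thesis
    proof (cases "m = 0")
      case True
      have "(1 - t) * a \<ge> 0" "t * b \<ge> 0" using ab assms(4,5) by simp_all
      with True have "(1 - t) * a = 0" "t * b = 0" unfolding m_def by linarith+
      then have "a = 0" "b = 0" using assms(4,5) by auto
      then show ?thesis by (simp add: a_def b_def)
    next
      case False
      have "m \<ge> 0" unfolding m_def using ab assms(4,5) by simp
      with False have m: "m > 0" by simp
      have "(1 - t) * (a * ln (m / \<pi> $ k) + a - m) \<le> (1 - t) * (a * ln (a / \<pi> $ k))"
        using x_ln_div_tangent[OF ab(1) m assms(3)[of k]] assms(5) by (intro mult_left_mono) auto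
      moreover have "t * (b * ln (m / \<pi> $ k) + b - m) \<le> t * (b * ln (b / \<pi> $ k))"
        using x_ln_div_tangent[OF ab(2) m assms(3)[of k]] assms(4) by (intro mult_left_mono) auto
      moreover have "(1 - t) * (a * ln (m / \<pi> $ k) + a - m) + t * (b * ln (m / \<pi> $ k) + b - m)
          = m * ln (m / \<pi> $ k)"
        unfolding m_def by (simp add: algebra_simps)
      ultimately show ?thesis by (simp add: a_def b_def m_def)
    qed
  qed
  then show ?thesis
    unfolding KL_def sum_distrib_left by (subst sum.distrib[symmetric]) (intro sum_mono)
qed

lemma axis_prob_vector: "axis k (1::real) \<in> prob_vectors"
  by (simp add: prob_vectors_def axis_def)

lemma sum_axis: "(\<Sum>k\<in>UNIV. axis K (1::real) $ k * f k) = f K"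
  by (simp add: axis_def if_distrib[of "\<lambda>x. x * _"] cong: if_cong)

lemma sum_axis_scaleR:
  fixes f :: "'k::finite \<Rightarrow> real^'n"
  shows "(\<Sum>k\<in>UNIV. axis K (1::real) $ k *\<^sub>R f k) = f K"
  by (simp add: axis_def if_distrib[of "\<lambda>x. x *\<^sub>R _"] cong: if_cong)

lemma KL_axis: "KL (axis K 1) \<pi> = ln (1 / \<pi> $ K)"
  unfolding KL_def sum_axis by simp

lemma weighted_square_dist:
  fixes \<theta> :: "real^'k" and v :: "'k \<Rightarrow> real^'n"
  assumes "\<theta> \<in> prob_vectors"
  shows "(\<Sum>k\<in>UNIV. \<theta> $ k * (norm (v k - c))\<^sup>2)
    = (\<Sum>k\<in>UNIV. \<theta> $ k * (v k \<bullet> v k)) - 2 * ((\<Sum>k\<in>UNIV. \<theta> $ k *\<^sub>R v k) \<bullet> c) + c \<bullet> c"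
proof -
  have "(\<Sum>k\<in>UNIV. \<theta> $ k * (norm (v k - c))\<^sup>2)
      = (\<Sum>k\<in>UNIV. \<theta> $ k * (v k \<bullet> v k) - 2 * (\<theta> $ k * (v k \<bullet> c)) + \<theta> $ k * (c \<bullet> c))"
    by (simp add: power2_norm_eq_inner inner_diff_left inner_diff_right inner_commute algebra_simps)
  also have "\<dots> = (\<Sum>k\<in>UNIV. \<theta> $ k * (v k \<bullet> v k)) - 2 * (\<Sum>k\<in>UNIV. \<theta> $ k * (v k \<bullet> c))
      + (\<Sum>k\<in>UNIV. \<theta> $ k) * (c \<bullet> c)"
    by (simp add: sum.distrib sum_subtractf sum_distrib_left sum_distrib_right)
  finally show ?thesis
    using assms by (simp add: prob_vectors_def inner_sum_left)
qed

lemma prob_vector_average_mono: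
  fixes \<theta> :: "real^'k"
  assumes "\<theta> \<in> prob_vectors" "\<And>k. f k \<le> g k"
  shows "(\<Sum>k\<in>UNIV. \<theta> $ k * f k) \<le> (\<Sum>k\<in>UNIV. \<theta> $ k * g k)"
  using assms by (intro sum_mono mult_left_mono) (auto simp: prob_vectors_def)

lemma prob_vector_average_const:
  fixes \<theta> :: "real^'k"
  assumes "\<theta> \<in> prob_vectors"
  shows "(\<Sum>k\<in>UNIV. \<theta> $ k * c) = c"
  using assms by (simp add: prob_vectors_def flip: sum_distrib_right)

section \<open>The noise, uniformly over the subsets\<close>

text \<open>The binomial coefficient in the prior cancels the number of subsets of a given size, so that the
sum is geometric with ratio \<open>e\<^bsup>-4/5\<^esup> \<le> 1/2\<close>.\<close>

lemma sum_prior_weight_tilted: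
  "(\<Sum>J\<in>(UNIV :: 'p::finite set set). prior_weight J * exp (card J / 5)) \<le> 2"
proof -
  define p where "p = CARD('p)"
  have card_eq: "(\<Sum>J | card (J :: 'p set) = k. prior_weight J * exp (card J / 5)) = exp (- 4 / 5) ^ k"
    if "k \<le> p" for k
  proof -
    have "card {J :: 'p set. card J = k} = p choose k"
      using n_subsets[of "UNIV :: 'p set" k] by (simp add: p_def)
    moreover have "p choose k > 0" using that by simp
    ultimately have "(\<Sum>J | card (J :: 'p set) = k. prior_weight J * exp (card J / 5))
        = exp (- real k) * exp (k / 5)"
      by (simp add: prior_weight_def p_def)
    also have "\<dots> = exp (- 4 / 5) ^ k"
      by (simp flip: exp_add exp_of_nat_mult)
    finally show ?thesis .
  qed
  have "card J \<le> p" for J :: "'p set"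
    unfolding p_def by (rule card_mono) auto
  then have "(\<Sum>J\<in>(UNIV :: 'p set set). prior_weight J * exp (card J / 5))
      = (\<Sum>k\<le>p. \<Sum>J | J \<in> UNIV \<and> card (J :: 'p set) = k. prior_weight J * exp (card J / 5))"
    by (intro sum.group[symmetric]) auto
  also have "\<dots> = (\<Sum>k\<le>p. exp (- 4 / 5) ^ k)"
    using card_eq by (intro sum.cong) auto
  also have "\<dots> \<le> (\<Sum>k\<le>p. (1 / 2) ^ k)"
  proof (intro sum_mono power_mono)
    have "ln (2::real) \<le> 4 / 5" using ln_2_less_1 ln2_le_25_over_36 by simp
    then have "exp (- 4 / 5) \<le> exp (- ln (2::real))" by simp
    also have "\<dots> = 1 / 2" by (simp add: exp_minus)
    finally show "exp (- 4 / 5) \<le> (1 / 2 :: real)" .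
  qed simp
  also have "\<dots> \<le> 2"
    by (simp add: sum_gp_strict lessThan_Suc_atMost[symmetric])
  finally show ?thesis .
qed

text \<open>The price of the set \<open>K\<close>, in units of the noise level: its dimension, its logarithmic prior weight up
to the normalization, and the confidence level.\<close>

definition complexity :: "real \<Rightarrow> 'p::finite set \<Rightarrow> real" where
  "complexity \<delta> K = 2 * card K + ln (CARD('p) choose card K) + ln (2 / \<delta>)"

text \<open>The prior average of exponentials of the squared noise that the Gibbs inequality produces; the prior
is left unnormalized because its normalization cancels in the end.
The coefficient \<open>3 / (20 \<sigma>\<^sup>2)\<close> is what the \<open>Q\<close>-aggregate with \<open>\<lambda> = 20 \<sigma>\<^sup>2\<close> needs: two thirds for the
cross terms, one third for the noise in the comparison estimator itself.\<close>

definition tilted_noise :: "real^'p^'n \<Rightarrow> real \<Rightarrow> 'p set \<Rightarrow> real^'n \<Rightarrow> real" where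
  "tilted_noise X \<sigma> K x =
     (\<Sum>J\<in>UNIV. prior_weight J * exp (3 * (norm (proj_mat X (J \<union> K) *v x))\<^sup>2 / (20 * \<sigma>\<^sup>2)))"

text \<open>The threshold is \<open>1 / \<delta>\<close> times a bound for the mean of the tilted noise.\<close>

definition low_noise :: "real^'p^'n \<Rightarrow> real \<Rightarrow> real \<Rightarrow> 'p set \<Rightarrow> real^'n \<Rightarrow> bool" where
  "low_noise X \<sigma> \<delta> K x \<longleftrightarrow> tilted_noise X \<sigma> K x \<le> 2 * exp (card K / 5) / \<delta>"

lemma complexity_nonneg:
  assumes "0 < \<delta>" "\<delta> \<le> 1"
  shows "0 \<le> complexity \<delta> (K :: 'p::finite set)"
proof -
  have "CARD('p) choose card K > 0" by (simp add: card_mono)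
  then have "0 \<le> ln (CARD('p) choose card K)" by (intro ln_ge_zero) linarith
  then show ?thesis using assms unfolding complexity_def by simp
qed

lemma continuous_tilted_noise: "continuous_on UNIV (tilted_noise X \<sigma> K)"
  unfolding tilted_noise_def divide_inverse
  by (intro continuous_intros linear_continuous_on) 
     (simp add: linear_linear)

text \<open>The exponential moment per dimension is \<open>(1 - 3/10)\<^bsup>-1/2\<^esup>\<close>, which is below \<open>e\<^bsup>1/5\<^esup>\<close>.\<close>

lemma proj_mat_noise_mgf:
  fixes X :: "real^'p^'n" and \<xi> :: "'a \<Rightarrow> real^'n"
  assumes "prob_space M" "0 < \<sigma>"
    and "distributed M lborel \<xi> (\<lambda>x. ennreal (\<Prod>i\<in>UNIV. normal_density 0 \<sigma> (x $ i)))"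
  shows "(\<integral>\<^sup>+\<omega>. ennreal (exp (3 * (norm (proj_mat X J *v \<xi> \<omega>))\<^sup>2 / (20 * \<sigma>\<^sup>2))) \<partial>M)
    \<le> ennreal (exp (card J / 5))"
proof -
  define s where "s = 3 / (20 * \<sigma>\<^sup>2)"
  have s: "0 \<le> s" "2 * s * \<sigma>\<^sup>2 = 3 / 10" using assms(2) by (auto simp: s_def)
  obtain B where B: "finite B" "card B \<le> card J" "pairwise orthogonal B"
      "\<And>b. b \<in> B \<Longrightarrow> norm b = 1" "\<And>y. proj_mat X J *v y = (\<Sum>b\<in>B. (y \<bullet> b) *\<^sub>R b)"
    by (rule proj_mat_orthonormal_basis[of J X]) (rule that)
  have n: "(norm (proj_mat X J *v y))\<^sup>2 = (\<Sum>b\<in>B. (y \<bullet> b)\<^sup>2)" for y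
  proof -
    have "(norm (\<Sum>b\<in>B. (y \<bullet> b) *\<^sub>R b))\<^sup>2 = (\<Sum>b\<in>B. (norm ((y \<bullet> b) *\<^sub>R b))\<^sup>2)"
      using B(1,3) by (intro norm_sum_Pythagorean) (auto simp: pairwise_def orthogonal_def)
    then show ?thesis using B(4) unfolding B(5) by (simp add: power_mult_distrib)
  qed
  have "(\<integral>\<^sup>+\<omega>. ennreal (exp (3 * (norm (proj_mat X J *v \<xi> \<omega>))\<^sup>2 / (20 * \<sigma>\<^sup>2))) \<partial>M)
      = (\<integral>\<^sup>+\<omega>. ennreal (exp (s * (\<Sum>b\<in>B. (\<xi> \<omega> \<bullet> b)\<^sup>2) + 0 \<bullet> \<xi> \<omega>)) \<partial>M)"
    unfolding n by (simp add: s_def)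
  also have "\<dots> = ennreal ((1 / sqrt (1 - 2 * s * \<sigma>\<^sup>2)) ^ card B * exp (\<sigma>\<^sup>2 * (norm (0::real^'n))\<^sup>2 / 2))"
    using s by (intro gaussian_orthonormal_square_mgf[OF assms(1,3,2) _ _ B(1,3,4)]) simp_all
  also have "\<dots> = ennreal ((1 / sqrt (7 / 10)) ^ card B)"
    by (simp add: s)
  also have "\<dots> \<le> ennreal (exp (1 / 5) ^ card B)"
  proof (intro ennreal_leI power_mono)
    have "7 / 10 \<ge> exp (- 2 / 5 :: real)"
    proof -
      have "1 + 2 / 5 + (2 / 5)\<^sup>2 / 2 \<le> exp (2 / 5 :: real)"
        by (rule exp_lower_Taylor_quadratic) simp
      then have "10 / 7 \<le> exp (2 / 5 :: real)" by (simp add: power2_eq_square)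
      then have "inverse (exp (2 / 5)) \<le> inverse (10 / 7 :: real)" by (intro le_imp_inverse_le) auto
      then show ?thesis by (simp add: exp_minus)
    qed
    then have "exp (- 1 / 5) \<le> sqrt (7 / 10 :: real)"
      by (intro real_le_rsqrt) (simp add: power2_eq_square flip: exp_add)
    then have "inverse (sqrt (7 / 10)) \<le> inverse (exp (- 1 / 5 :: real))"
      by (intro le_imp_inverse_le) auto
    then show "1 / sqrt (7 / 10) \<le> exp (1 / 5 :: real)" by (simp add: exp_minus inverse_eq_divide)
  qed simp
  also have "\<dots> \<le> ennreal (exp (card J / 5))"
    using B(2) by (intro ennreal_leI) (simp flip: exp_of_nat_mult)
  finally show ?thesis .
qed

lemma prob_low_noise:
  fixes X :: "real^'p^'n" and \<xi> :: "'a \<Rightarrow> real^'n"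
  assumes "prob_space M" "0 < \<sigma>"
    and \<xi>: "distributed M lborel \<xi> (\<lambda>x. ennreal (\<Prod>i\<in>UNIV. normal_density 0 \<sigma> (x $ i)))"
    and \<delta>: "0 < \<delta>"
  shows "measure M {\<omega> \<in> space M. low_noise X \<sigma> \<delta> K (\<xi> \<omega>)} \<ge> 1 - \<delta>"
proof -
  interpret prob_space M by fact
  have [measurable]: "\<xi> \<in> borel_measurable M"
    using distributed_measurable[OF \<xi>] by simp
  have [measurable]: "tilted_noise X \<sigma> K \<in> borel_measurable borel"
    by (rule borel_measurable_continuous_onI[OF continuous_tilted_noise])
  have [measurable]: "(\<lambda>\<omega>. exp (3 * (norm (proj_mat X J *v \<xi> \<omega>))\<^sup>2 / (20 * \<sigma>\<^sup>2))) \<in> borel_measurable M" for J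
  proof -
    have "(\<lambda>y. proj_mat X J *v y) \<in> borel_measurable borel"
      by (intro borel_measurable_continuous_onI linear_continuous_on) (simp add: linear_linear)
    then have [measurable]: "(\<lambda>\<omega>. proj_mat X J *v \<xi> \<omega>) \<in> borel_measurable M"
      by measurable
    show ?thesis by measurable
  qed
  define c where "c = 2 * exp (card K / 5)"
  have c: "c > 0" by (simp add: c_def)
  have "(\<integral>\<^sup>+\<omega>. ennreal (tilted_noise X \<sigma> K (\<xi> \<omega>)) \<partial>M)
      = (\<integral>\<^sup>+\<omega>. (\<Sum>J\<in>UNIV. ennreal (prior_weight J)
          * ennreal (exp (3 * (norm (proj_mat X (J \<union> K) *v \<xi> \<omega>))\<^sup>2 / (20 * \<sigma>\<^sup>2)))) \<partial>M)"
    unfolding tilted_noise_def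
    by (intro nn_integral_cong)
       (simp add: less_imp_le[OF prior_weight_pos] flip: ennreal_mult)
  also have "\<dots> = (\<Sum>J\<in>UNIV. ennreal (prior_weight J)
      * (\<integral>\<^sup>+\<omega>. ennreal (exp (3 * (norm (proj_mat X (J \<union> K) *v \<xi> \<omega>))\<^sup>2 / (20 * \<sigma>\<^sup>2))) \<partial>M))"
    by (subst nn_integral_sum) (simp_all add: nn_integral_cmult)
  also have "\<dots> \<le> (\<Sum>J\<in>UNIV. ennreal (prior_weight (J :: 'p set)) * ennreal (exp (card J / 5) * exp (card K / 5)))"
  proof (intro sum_mono mult_left_mono)
    fix J :: "'p set"
    have "real (card (J \<union> K)) \<le> card J + card K" using card_Un_le[of J K] by linarith
    then have "exp (card (J \<union> K) / 5) \<le> exp (card J / 5) * exp (card K / 5)"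
      by (simp flip: exp_add)
    then show "(\<integral>\<^sup>+\<omega>. ennreal (exp (3 * (norm (proj_mat X (J \<union> K) *v \<xi> \<omega>))\<^sup>2 / (20 * \<sigma>\<^sup>2))) \<partial>M)
        \<le> ennreal (exp (card J / 5) * exp (card K / 5))"
      using proj_mat_noise_mgf[OF assms(1-3), of X "J \<union> K"] by (meson ennreal_leI order_trans)
  qed simp
  also have "\<dots> = ennreal ((\<Sum>J\<in>UNIV. prior_weight (J :: 'p set) * exp (card J / 5)) * exp (card K / 5))"
    by (simp add: less_imp_le[OF prior_weight_pos] sum_distrib_right mult.assoc flip: ennreal_mult)
  also have "\<dots> \<le> ennreal c"
    unfolding c_def by (intro ennreal_leI mult_right_mono sum_prior_weight_tilted) simp
  finally have mean: "(\<integral>\<^sup>+\<omega>. ennreal (tilted_noise X \<sigma> K (\<xi> \<omega>)) \<partial>M) \<le> ennreal c" .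
  have "emeasure M {\<omega> \<in> space M. 1 \<le> ennreal (\<delta> / c) * ennreal (tilted_noise X \<sigma> K (\<xi> \<omega>))}
      \<le> ennreal (\<delta> / c) * (\<integral>\<^sup>+\<omega>. ennreal (tilted_noise X \<sigma> K (\<xi> \<omega>)) * indicator (space M) \<omega> \<partial>M)"
    by (intro nn_integral_Markov_inequality) measurable
  also have "\<dots> \<le> ennreal (\<delta> / c) * ennreal c"
    using mean by (intro mult_left_mono) (auto simp: nn_integral_cong[of M "\<lambda>\<omega>. _ * indicator (space M) \<omega>"])
  also have "\<dots> = ennreal \<delta>" using c \<delta> by (simp flip: ennreal_mult)
  finally have markov: "emeasure M {\<omega> \<in> space M. 1 \<le> ennreal (\<delta> / c) * ennreal (tilted_noise X \<sigma> K (\<xi> \<omega>))}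
      \<le> ennreal \<delta>" .
  have tn: "tilted_noise X \<sigma> K x \<ge> 0" for x
    unfolding tilted_noise_def by (intro sum_nonneg mult_nonneg_nonneg less_imp_le[OF prior_weight_pos]) simp
  have "emeasure M {\<omega> \<in> space M. \<not> low_noise X \<sigma> \<delta> K (\<xi> \<omega>)}
      \<le> emeasure M {\<omega> \<in> space M. 1 \<le> ennreal (\<delta> / c) * ennreal (tilted_noise X \<sigma> K (\<xi> \<omega>))}"
  proof (rule emeasure_mono)
    show "{\<omega> \<in> space M. \<not> low_noise X \<sigma> \<delta> K (\<xi> \<omega>)}
        \<subseteq> {\<omega> \<in> space M. 1 \<le> ennreal (\<delta> / c) * ennreal (tilted_noise X \<sigma> K (\<xi> \<omega>))}"
      using c \<delta> tn by (auto simp: low_noise_def c_def[symmetric] not_le field_simps simp flip: ennreal_mult ennreal_1)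
  qed measurable
  from order_trans[OF this markov] have "ennreal (prob {\<omega> \<in> space M. \<not> low_noise X \<sigma> \<delta> K (\<xi> \<omega>)}) \<le> ennreal \<delta>"
    by (simp add: emeasure_eq_measure)
  then have "prob {\<omega> \<in> space M. \<not> low_noise X \<sigma> \<delta> K (\<xi> \<omega>)} \<le> \<delta>"
    using \<delta> by (simp add: ennreal_le_iff)
  moreover have "prob {\<omega> \<in> space M. \<not> low_noise X \<sigma> \<delta> K (\<xi> \<omega>)} = 1 - prob {\<omega> \<in> space M. low_noise X \<sigma> \<delta> K (\<xi> \<omega>)}"
    unfolding low_noise_def by (rule prob_neg) measurable
  ultimately show ?thesis by simp
qed

text \<open>The Gibbs inequality on the event of low noise. The normalization of the prior occurs in
\<open>ln (1 / \<pi>\<^sub>K)\<close> and, with the opposite sign, in the prior average of exponentials, so it disappears. The slack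
\<open>4/5 |K|\<close> pays for the penalty \<open>C\<^sub>K \<le> 4 \<sigma>\<^sup>2 |K|\<close>.\<close>

lemma low_noise_bound:
  fixes X :: "real^'p^'n" and K :: "'p set"
  assumes "0 < \<sigma>" "0 < \<delta>" "low_noise X \<sigma> \<delta> K x" "\<theta> \<in> prob_vectors"
  shows "3 * (\<Sum>J\<in>UNIV. \<theta> $ J * (norm (proj_mat X (J \<union> K) *v x))\<^sup>2)
      + 20 * \<sigma>\<^sup>2 * (ln (1 / sparsity_prior $ K) - KL \<theta> sparsity_prior)
    \<le> 20 * \<sigma>\<^sup>2 * (complexity \<delta> K - 4 / 5 * card K)"
proof -
  define Z where "Z = (\<Sum>J\<in>(UNIV :: 'p set set). prior_weight J)"
  have Z: "Z > 0" unfolding Z_def by (simp add: prior_weight_pos sum_pos)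
  define h where "h J = 3 * (norm (proj_mat X (J \<union> K) *v x))\<^sup>2 / (20 * \<sigma>\<^sup>2)" for J
  have prior: "sparsity_prior $ J = prior_weight J / Z" for J :: "'p set"
    by (simp add: sparsity_prior_def Z_def)
  have "(\<Sum>J\<in>UNIV. sparsity_prior $ J * exp (h J)) = tilted_noise X \<sigma> K x / Z"
    by (simp add: prior tilted_noise_def h_def sum_divide_distrib)
  also have "\<dots> \<le> 2 * exp (card K / 5) / \<delta> / Z"
    using assms(3) Z unfolding low_noise_def by (intro divide_right_mono) auto
  finally have "(\<Sum>J\<in>UNIV. \<theta> $ J * h J) \<le> KL \<theta> sparsity_prior + ln (2 * exp (card K / 5) / \<delta> / Z)"
    by (intro KL_variational assms(4) sparsity_prior_pos)
  also have "ln (2 * exp (card K / 5) / \<delta> / Z) = ln (2 / \<delta>) + card K / 5 - ln Z"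
    using Z assms(2) by (simp add: ln_div ln_mult)
  finally have dv: "(\<Sum>J\<in>UNIV. \<theta> $ J * h J)
      \<le> KL \<theta> sparsity_prior + (ln (2 / \<delta>) + card K / 5 - ln Z)" .
  have "CARD('p) choose card K > 0" by (simp add: card_mono)
  then have "ln (1 / sparsity_prior $ K) = card K + ln (CARD('p) choose card K) + ln Z"
    using Z by (simp add: prior prior_weight_def ln_div ln_mult)
  with dv have "(\<Sum>J\<in>UNIV. \<theta> $ J * h J) + ln (1 / sparsity_prior $ K) - KL \<theta> sparsity_prior
      \<le> complexity \<delta> K - 4 / 5 * card K"
    by (simp add: complexity_def)
  then have "20 * \<sigma>\<^sup>2 * ((\<Sum>J\<in>UNIV. \<theta> $ J * h J) + ln (1 / sparsity_prior $ K) - KL \<theta> sparsity_prior)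
      \<le> 20 * \<sigma>\<^sup>2 * (complexity \<delta> K - 4 / 5 * card K)"
    by (intro mult_left_mono) auto
  moreover have "20 * \<sigma>\<^sup>2 * (\<Sum>J\<in>UNIV. \<theta> $ J * h J)
      = 3 * (\<Sum>J\<in>UNIV. \<theta> $ J * (norm (proj_mat X (J \<union> K) *v x))\<^sup>2)"
    using assms(1) by (simp add: h_def sum_distrib_left mult_ac)
  ultimately show ?thesis by (simp add: algebra_simps)
qed

section \<open>Oracle inequalities on the event of low noise\<close>

text \<open>Only the part \<open>1/2 \<parallel>Y - \<mu>\<^sub>\<theta>\<parallel>\<^sup>2\<close> of the criterion is used for the curvature: comparing the minimizer with
the convex combinations \<open>(1 - t) \<theta> + t \<theta>'\<close> and letting \<open>t\<close> tend to \<open>0\<close> avoids derivatives of the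
entropy, which are infinite at the boundary of the simplex.\<close>

lemma Q_fun_strong_convexity:
  fixes X :: "real^'p^'n"
  assumes min: "is_arg_min (Q_fun X \<sigma> (1 / 2) lam y) (\<lambda>\<theta>. \<theta> \<in> prob_vectors) \<theta>"
    and \<theta>': "\<theta>' \<in> prob_vectors" and lam: "0 \<le> lam"
  shows "Q_fun X \<sigma> (1 / 2) lam y \<theta> + (norm (mix X y \<theta>' - mix X y \<theta>))\<^sup>2 / 2
    \<le> Q_fun X \<sigma> (1 / 2) lam y \<theta>'"
proof -
  let ?Q = "Q_fun X \<sigma> (1 / 2) lam y" and ?d = "(norm (mix X y \<theta>' - mix X y \<theta>))\<^sup>2 / 2"
  have \<theta>: "\<theta> \<in> prob_vectors" using min by (simp add: is_arg_min_def)
  have "s * ?d \<le> ?Q \<theta>' - ?Q \<theta>" if s: "0 < s" "s < 1" for s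
  proof -
    \<comment> \<open>The weight \<open>s\<close> of the minimizer tends to \<open>1\<close>.\<close>
    define t where "t = 1 - s"
    have t: "0 < t" "t < 1" using s by (auto simp: t_def)
    define w where "w = (1 - t) *\<^sub>R \<theta> + t *\<^sub>R \<theta>'"
    have w: "w \<in> prob_vectors"
      using \<theta> \<theta>' t unfolding prob_vectors_def w_def
      by (auto simp: sum.distrib simp flip: sum_distrib_left)
    have lin: "(\<Sum>J\<in>UNIV. w $ J * g J)
        = (1 - t) * (\<Sum>J\<in>UNIV. \<theta> $ J * g J) + t * (\<Sum>J\<in>UNIV. \<theta>' $ J * g J)" for g
      unfolding w_def by (simp add: sum.distrib sum_distrib_left distrib_right mult.assoc)
    have mixw: "mix X y w = (1 - t) *\<^sub>R mix X y \<theta> + t *\<^sub>R mix X y \<theta>'"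
      unfolding w_def mix_def by (simp add: sum.distrib scaleR_sum_right scaleR_add_left)
    have sq: "(norm (y - mix X y w))\<^sup>2 = (1 - t) * (norm (y - mix X y \<theta>))\<^sup>2
        + t * (norm (y - mix X y \<theta>'))\<^sup>2 - t * (1 - t) * (norm (mix X y \<theta>' - mix X y \<theta>))\<^sup>2"
      unfolding mixw power2_norm_eq_inner
      by (simp add: inner_diff_left inner_diff_right inner_add_left inner_add_right inner_commute
          algebra_simps)
    have kl: "lam * KL w sparsity_prior
        \<le> lam * ((1 - t) * KL \<theta> sparsity_prior + t * KL \<theta>' sparsity_prior)"
      unfolding w_def by (intro mult_left_mono lam KL_convex \<theta> \<theta>' t sparsity_prior_pos)
    have "?Q \<theta> \<le> ?Q w" using min w by (simp add: is_arg_min_linorder)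
    also have "?Q w \<le> (1 - t) * ?Q \<theta> + t * ?Q \<theta>' - t * (1 - t) * ?d"
      using kl unfolding Q_fun_def lin sq by (simp add: algebra_simps add_divide_distrib diff_divide_distrib)
    finally have "t * (s * ?d) \<le> t * (?Q \<theta>' - ?Q \<theta>)"
      by (simp add: t_def algebra_simps)
    then show ?thesis using t by simp
  qed
  then have "?d \<le> ?Q \<theta>' - ?Q \<theta>" by (rule field_le_mult_one_interval)
  then show ?thesis by simp
qed

text \<open>Strong convexity is applied to the point mass at \<open>K\<close>. The two quadratic terms
\<open>1/2 \<Sum>\<^sub>J \<theta>\<^sub>J \<parallel>f\<^sub>J - \<mu>\<^sub>\<theta>\<parallel>\<^sup>2\<close> and \<open>1/2 \<parallel>f\<^sub>K - \<mu>\<^sub>\<theta>\<parallel>\<^sup>2\<close> add up to \<open>1/2 \<Sum>\<^sub>J \<theta>\<^sub>J \<parallel>f\<^sub>J - f\<^sub>K\<parallel>\<^sup>2\<close>, which cancels the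
quadratic part of the cross terms.\<close>

lemma Q_aggregate_oracle_inequality:
  fixes X :: "real^'p^'n"
  assumes "0 < \<sigma>" "0 < \<delta>" "\<delta> \<le> 1"
    and min: "is_arg_min (Q_fun X \<sigma> (1 / 2) (20 * \<sigma>\<^sup>2) (\<mu> + x)) (\<lambda>\<theta>. \<theta> \<in> prob_vectors) \<theta>"
    and noise: "low_noise X \<sigma> \<delta> K x"
  shows "(norm (mix X (\<mu> + x) \<theta> - \<mu>))\<^sup>2
    \<le> (norm (proj_mat X K *v \<mu> - \<mu>))\<^sup>2 + (9 * \<sigma>)\<^sup>2 / 4 * complexity \<delta> K"
proof -
  define y where "y = \<mu> + x"
  define f where "f J = least_squares X J y" for J
  define m where "m = mix X y \<theta>"
  define N where "N = (\<Sum>J\<in>UNIV. \<theta> $ J * (norm (proj_mat X (J \<union> K) *v x))\<^sup>2)"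
  define A where "A = (\<Sum>J\<in>UNIV. \<theta> $ J * (f J \<bullet> f J))"
  define S where "S = (\<Sum>J\<in>UNIV. \<theta> $ J * C_pen X \<sigma> J)"
  have \<theta>: "\<theta> \<in> prob_vectors" using min by (simp add: is_arg_min_def)
  have m_eq: "m = (\<Sum>J\<in>UNIV. \<theta> $ J *\<^sub>R f J)" by (simp add: m_def mix_def f_def)
  have mixK: "mix X y (axis K 1) = f K" unfolding mix_def sum_axis_scaleR f_def ..
  have sq: "(\<Sum>J\<in>UNIV. \<theta> $ J * (norm (f J - c))\<^sup>2) = A - 2 * (m \<bullet> c) + c \<bullet> c" for c
    unfolding A_def m_eq by (rule weighted_square_dist[OF \<theta>])
  have S: "S \<ge> 0" unfolding S_def using prob_vector_average_mono[OF \<theta> C_pen_bounds(1)] by simp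
  have QK: "Q_fun X \<sigma> (1 / 2) (20 * \<sigma>\<^sup>2) y (axis K 1)
      = (norm (y - f K))\<^sup>2 + C_pen X \<sigma> K + 20 * \<sigma>\<^sup>2 * ln (1 / sparsity_prior $ K)"
    unfolding Q_fun_def sum_axis mixK KL_axis by (simp add: f_def)
  have Q\<theta>: "Q_fun X \<sigma> (1 / 2) (20 * \<sigma>\<^sup>2) y \<theta>
      = (A - 2 * (m \<bullet> y) + y \<bullet> y) / 2 + (norm (y - m))\<^sup>2 / 2 + S
        + 20 * \<sigma>\<^sup>2 * KL \<theta> sparsity_prior"
    unfolding Q_fun_def S_def m_def[symmetric] f_def[symmetric] norm_minus_commute[of y] sq by simp
  have opt: "Q_fun X \<sigma> (1 / 2) (20 * \<sigma>\<^sup>2) y \<theta> + (norm (f K - m))\<^sup>2 / 2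
      \<le> Q_fun X \<sigma> (1 / 2) (20 * \<sigma>\<^sup>2) y (axis K 1)"
    using Q_fun_strong_convexity[OF min axis_prob_vector, of K] unfolding y_def[symmetric] mixK m_def
    by simp
  have pointwise: "2 * (x \<bullet> f J) - 2 * (x \<bullet> f K) - (norm (f J - f K))\<^sup>2 / 2
      \<le> 2 * (norm (proj_mat X (J \<union> K) *v x))\<^sup>2" for J
    using inner_least_squares_diff_le[of 2 x X J y K] by (simp add: f_def inner_diff_right)
  have cross: "2 * (x \<bullet> m) - 2 * (x \<bullet> f K) - (A - 2 * (m \<bullet> f K) + f K \<bullet> f K) / 2 \<le> 2 * N"
  proof -
    have "(\<Sum>J\<in>UNIV. \<theta> $ J * (2 * (x \<bullet> f J) - 2 * (x \<bullet> f K) - (norm (f J - f K))\<^sup>2 / 2))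
      = (\<Sum>J\<in>UNIV. 2 * (\<theta> $ J * (x \<bullet> f J)) - \<theta> $ J * (2 * (x \<bullet> f K))
           - (\<theta> $ J * (norm (f J - f K))\<^sup>2) / 2)"
      by (simp add: algebra_simps)
    also have "\<dots> = 2 * (x \<bullet> m) - 2 * (x \<bullet> f K) - (A - 2 * (m \<bullet> f K) + f K \<bullet> f K) / 2"
    proof -
      have "(\<Sum>J\<in>UNIV. \<theta> $ J * (x \<bullet> f J)) = x \<bullet> m"
        by (simp add: m_eq inner_sum_right)
      then show ?thesis
        using prob_vector_average_const[OF \<theta>, of "2 * (x \<bullet> f K)"]
        by (simp add: sum_subtractf sq flip: sum_distrib_left sum_divide_distrib)
    qed
    finally have "2 * (x \<bullet> m) - 2 * (x \<bullet> f K) - (A - 2 * (m \<bullet> f K) + f K \<bullet> f K) / 2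
        \<le> (\<Sum>J\<in>UNIV. \<theta> $ J * (2 * (norm (proj_mat X (J \<union> K) *v x))\<^sup>2))"
      using prob_vector_average_mono[OF \<theta> pointwise, of "\<lambda>J. J"] by simp
    then show ?thesis by (simp add: N_def sum_distrib_left mult.left_commute)
  qed
  have "(norm (proj_mat X K *v x))\<^sup>2 \<le> (norm (proj_mat X (J \<union> K) *v x))\<^sup>2" for J
    by (intro power_mono norm_proj_mat_mono) auto
  from prob_vector_average_mono[OF \<theta> this] have NK: "(norm (proj_mat X K *v x))\<^sup>2 \<le> N"
    by (simp add: N_def prob_vector_average_const[OF \<theta>])
  have fK: "(norm (f K - \<mu>))\<^sup>2 = (norm (proj_mat X K *v \<mu> - \<mu>))\<^sup>2 + (norm (proj_mat X K *v x))\<^sup>2"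
    unfolding f_def y_def by (rule norm_least_squares_error)
  have "(norm (m - \<mu>))\<^sup>2 \<le> (norm (f K - \<mu>))\<^sup>2 + C_pen X \<sigma> K
      + 20 * \<sigma>\<^sup>2 * (ln (1 / sparsity_prior $ K) - KL \<theta> sparsity_prior) + 2 * N"
    using opt[unfolded QK Q\<theta>] cross S unfolding power2_norm_eq_inner y_def
    by (simp add: inner_diff_left inner_diff_right inner_add_left inner_add_right inner_commute
        algebra_simps) argo
  also have "\<dots> \<le> (norm (proj_mat X K *v \<mu> - \<mu>))\<^sup>2 + C_pen X \<sigma> K
      + 20 * \<sigma>\<^sup>2 * (ln (1 / sparsity_prior $ K) - KL \<theta> sparsity_prior) + 3 * N"
    unfolding fK using NK by simp
  also have "\<dots> \<le> (norm (proj_mat X K *v \<mu> - \<mu>))\<^sup>2 + 4 * \<sigma>\<^sup>2 * card K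
      + 20 * \<sigma>\<^sup>2 * (complexity \<delta> K - 4 / 5 * card K)"
    using low_noise_bound[OF assms(1,2) noise \<theta>] C_pen_bounds(2)[of X \<sigma> K] by (simp add: N_def)
  also have "\<dots> \<le> (norm (proj_mat X K *v \<mu> - \<mu>))\<^sup>2 + 20 * \<sigma>\<^sup>2 * complexity \<delta> K"
    by (simp add: algebra_simps)
  also have "20 * \<sigma>\<^sup>2 * complexity \<delta> K \<le> (9 * \<sigma>)\<^sup>2 / 4 * complexity \<delta> K"
    using complexity_nonneg[of \<delta> K] assms(2,3)
    by (intro mult_right_mono) (auto simp: power_mult_distrib)
  finally show ?thesis by (simp add: m_def y_def)
qed

text \<open>Exponential weights minimize the linear criterion with entropy penalty; the minimum is minus
\<open>\<lambda>\<close> times the logarithm of the normalizing sum, and this sum is at least its term at \<open>K\<close>.\<close>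

lemma exponential_weights_gibbs:
  fixes X :: "real^'p^'n" and \<sigma> :: real
  defines "E \<equiv> \<lambda>y J. (norm (y - least_squares X J y))\<^sup>2 + C_pen X \<sigma> J"
  assumes lam: "0 < lam"
    and \<theta>_def: "\<theta> = (\<chi> J. EW_weight X \<sigma> lam y J / (\<Sum>K\<in>UNIV. EW_weight X \<sigma> lam y K))"
  shows "\<theta> \<in> prob_vectors"
    and "(\<Sum>J\<in>UNIV. \<theta> $ J * E y J) + lam * KL \<theta> sparsity_prior
      \<le> E y K + lam * ln (1 / sparsity_prior $ K)"
proof -
  define W where "W = (\<Sum>K\<in>UNIV. EW_weight X \<sigma> lam y K)"
  have w: "EW_weight X \<sigma> lam y J > 0" for J
    unfolding EW_weight_def by (simp add: sparsity_prior_pos)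
  have W: "W > 0" unfolding W_def by (intro sum_pos w) auto
  show \<theta>: "\<theta> \<in> prob_vectors"
    using W unfolding prob_vectors_def \<theta>_def W_def[symmetric]
    by (auto simp: less_imp_le[OF w] simp flip: sum_divide_distrib W_def)
  have log_weight: "lam * ln (\<theta> $ J / sparsity_prior $ J) = - E y J - lam * ln W" for J
  proof -
    have "\<theta> $ J / sparsity_prior $ J = exp (- E y J / lam) / W"
      using sparsity_prior_pos[of J] unfolding \<theta>_def W_def[symmetric]
      by (simp add: EW_weight_def E_def)
    then have "ln (\<theta> $ J / sparsity_prior $ J) = - E y J / lam - ln W"
      using W by (simp only:) (simp add: ln_div)
    then show ?thesis using lam by (simp add: right_diff_distrib)
  qed
  have "\<theta> $ J * (lam * ln (\<theta> $ J / sparsity_prior $ J)) = - (\<theta> $ J * E y J) - \<theta> $ J * (lam * ln W)" for J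
    unfolding log_weight by (simp add: right_diff_distrib)
  then have "lam * KL \<theta> sparsity_prior = - (\<Sum>J\<in>UNIV. \<theta> $ J * E y J) - lam * ln W"
    using prob_vector_average_const[OF \<theta>, of "lam * ln W"]
    by (simp add: KL_def sum_distrib_left mult.left_commute[of lam] sum_subtractf sum_negf)
  moreover have "- (lam * ln W) \<le> E y K + lam * ln (1 / sparsity_prior $ K)"
  proof -
    have "ln (EW_weight X \<sigma> lam y K) \<le> ln W"
      using w W unfolding W_def by (subst ln_le_cancel_iff) (auto intro!: member_le_sum less_imp_le[OF w])
    moreover have "ln (EW_weight X \<sigma> lam y K) = - E y K / lam - ln (1 / sparsity_prior $ K)"
      using sparsity_prior_pos[of K] by (simp add: EW_weight_def E_def ln_mult ln_div)
    ultimately have "lam * (- E y K / lam - ln (1 / sparsity_prior $ K)) \<le> lam * ln W"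
      using lam by (intro mult_left_mono) auto
    then show ?thesis using lam by (simp add: right_diff_distrib)
  qed
  ultimately show "(\<Sum>J\<in>UNIV. \<theta> $ J * E y J) + lam * KL \<theta> sparsity_prior
      \<le> E y K + lam * ln (1 / sparsity_prior $ K)"
    by linarith
qed

text \<open>The linear criterion has no curvature, so the quadratic part of the cross terms is bounded by
\<open>\<parallel>f\<^sub>J - f\<^sub>K\<parallel>\<^sup>2 \<le> 2 \<parallel>f\<^sub>J - \<mu>\<parallel>\<^sup>2 + 2 \<parallel>f\<^sub>K - \<mu>\<parallel>\<^sup>2\<close> and moved into the losses. The noise then appears with the
factor \<open>8 + 5/4\<close>, which is below the factor \<open>3 \<cdot> 64 / 20 = 48/5\<close> that the event of low noise allows for
\<open>\<lambda> = 64 \<sigma>\<^sup>2\<close>.\<close>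

lemma EW_aggregate_oracle_inequality:
  fixes X :: "real^'p^'n"
  assumes "0 < \<sigma>" "0 < \<delta>" "\<delta> \<le> 1"
    and noise: "low_noise X \<sigma> \<delta> K x"
  shows "(norm (EW_aggregate X \<sigma> (64 * \<sigma>\<^sup>2) (\<mu> + x) - \<mu>))\<^sup>2
    \<le> 5 / 3 * ((norm (proj_mat X K *v \<mu> - \<mu>))\<^sup>2 + (16 * \<sigma>)\<^sup>2 / 4 * complexity \<delta> K)"
proof -
  define y where "y = \<mu> + x"
  define f where "f J = least_squares X J y" for J
  define \<theta> where "\<theta> = (\<chi> J. EW_weight X \<sigma> (64 * \<sigma>\<^sup>2) y J / (\<Sum>K\<in>UNIV. EW_weight X \<sigma> (64 * \<sigma>\<^sup>2) y K))"
  define m where "m = mix X y \<theta>"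
  define N where "N = (\<Sum>J\<in>UNIV. \<theta> $ J * (norm (proj_mat X (J \<union> K) *v x))\<^sup>2)"
  define A where "A = (\<Sum>J\<in>UNIV. \<theta> $ J * (f J \<bullet> f J))"
  define S where "S = (\<Sum>J\<in>UNIV. \<theta> $ J * C_pen X \<sigma> J)"
  define D where "D = (\<Sum>J\<in>UNIV. \<theta> $ J * (norm (f J - \<mu>))\<^sup>2)"
  define kl where "kl = ln (1 / sparsity_prior $ K) - KL \<theta> sparsity_prior"
  have lam: "0 < 64 * \<sigma>\<^sup>2" using assms(1) by simp
  note gibbs = exponential_weights_gibbs[OF lam \<theta>_def]
  have \<theta>: "\<theta> \<in> prob_vectors" by (rule gibbs(1))
  have m_eq: "m = (\<Sum>J\<in>UNIV. \<theta> $ J *\<^sub>R f J)" by (simp add: m_def mix_def f_def)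
  have sq: "(\<Sum>J\<in>UNIV. \<theta> $ J * (norm (f J - c))\<^sup>2) = A - 2 * (m \<bullet> c) + c \<bullet> c" for c
    unfolding A_def m_eq by (rule weighted_square_dist[OF \<theta>])
  have S: "S \<ge> 0" unfolding S_def using prob_vector_average_mono[OF \<theta> C_pen_bounds(1)] by simp
  have opt: "A - 2 * (m \<bullet> y) + y \<bullet> y + S \<le> (norm (f K - y))\<^sup>2 + C_pen X \<sigma> K + 64 * \<sigma>\<^sup>2 * kl"
  proof -
    have "(\<Sum>J\<in>UNIV. \<theta> $ J * ((norm (y - f J))\<^sup>2 + C_pen X \<sigma> J))
        = A - 2 * (m \<bullet> y) + y \<bullet> y + S"
      by (simp add: sq[symmetric] S_def distrib_left sum.distrib norm_minus_commute[of y])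
    then show ?thesis
      using gibbs(2)[of K] by (simp add: kl_def f_def right_diff_distrib norm_minus_commute[of y])
  qed
  have D: "D = A - 2 * (m \<bullet> \<mu>) + \<mu> \<bullet> \<mu>" unfolding D_def by (rule sq)
  have jensen: "(norm (m - \<mu>))\<^sup>2 \<le> D"
  proof -
    have "0 \<le> (\<Sum>J\<in>UNIV. \<theta> $ J * (norm (f J - m))\<^sup>2)"
      using \<theta> by (intro sum_nonneg) (auto simp: prob_vectors_def)
    then show ?thesis
      unfolding sq D unfolding power2_norm_eq_inner by (simp add: inner_diff_left inner_diff_right inner_commute)
  qed
  have pointwise: "2 * (x \<bullet> f J) - 2 * (x \<bullet> f K)
      \<le> 8 * (norm (proj_mat X (J \<union> K) *v x))\<^sup>2 + (norm (f J - \<mu>))\<^sup>2 / 4 + (norm (f K - \<mu>))\<^sup>2 / 4" for J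
  proof -
    have "(norm (f J - f K))\<^sup>2 \<le> 2 * (norm (f J - \<mu>))\<^sup>2 + 2 * (norm (f K - \<mu>))\<^sup>2"
    proof -
      have "norm (f J - f K) \<le> norm (f J - \<mu>) + norm (f K - \<mu>)"
        using norm_triangle_ineq4[of "f J - \<mu>" "f K - \<mu>"] by simp
      then have "(norm (f J - f K))\<^sup>2 \<le> (norm (f J - \<mu>) + norm (f K - \<mu>))\<^sup>2"
        by (intro power_mono) auto
      also have "\<dots> \<le> 2 * (norm (f J - \<mu>))\<^sup>2 + 2 * (norm (f K - \<mu>))\<^sup>2"
        using sum_squares_bound[of "norm (f J - \<mu>)" "norm (f K - \<mu>)"] by (simp add: power2_sum)
      finally show ?thesis .
    qed
    then show ?thesis
      using inner_least_squares_diff_le[of 8 x X J y K] by (simp add: f_def inner_diff_right)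
  qed
  have cross: "2 * (x \<bullet> m) - 2 * (x \<bullet> f K) \<le> 8 * N + D / 4 + (norm (f K - \<mu>))\<^sup>2 / 4"
    using prob_vector_average_mono[OF \<theta> pointwise, of "\<lambda>J. J"]
      prob_vector_average_const[OF \<theta>, of "2 * (x \<bullet> f K)"]
      prob_vector_average_const[OF \<theta>, of "(norm (f K - \<mu>))\<^sup>2 / 4"]
    by (simp add: distrib_left right_diff_distrib sum.distrib sum_subtractf m_eq inner_sum_right
        N_def D_def sum_distrib_left sum_divide_distrib mult.left_commute)
  have "(norm (proj_mat X K *v x))\<^sup>2 \<le> (norm (proj_mat X (J \<union> K) *v x))\<^sup>2" for J
    by (intro power_mono norm_proj_mat_mono) auto
  from prob_vector_average_mono[OF \<theta> this] have NK: "(norm (proj_mat X K *v x))\<^sup>2 \<le> N"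
    by (simp add: N_def prob_vector_average_const[OF \<theta>])
  have fK: "(norm (f K - \<mu>))\<^sup>2 = (norm (proj_mat X K *v \<mu> - \<mu>))\<^sup>2 + (norm (proj_mat X K *v x))\<^sup>2"
    unfolding f_def y_def by (rule norm_least_squares_error)
  have "D \<le> (norm (f K - \<mu>))\<^sup>2 + 2 * (x \<bullet> m) - 2 * (x \<bullet> f K) + C_pen X \<sigma> K + 64 * \<sigma>\<^sup>2 * kl"
    using opt S unfolding D power2_norm_eq_inner y_def
    by (simp add: inner_diff_left inner_diff_right inner_add_left inner_add_right inner_commute)
  with cross NK have "3 / 4 * D \<le> 5 / 4 * (norm (proj_mat X K *v \<mu> - \<mu>))\<^sup>2 + 48 / 5 * N
      + C_pen X \<sigma> K + 64 * \<sigma>\<^sup>2 * kl"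
    unfolding fK using zero_le_power2[of "norm (proj_mat X K *v x)"] by argo
  also have "\<dots> \<le> 5 / 4 * (norm (proj_mat X K *v \<mu> - \<mu>))\<^sup>2 + 4 * \<sigma>\<^sup>2 * card K
      + 64 * \<sigma>\<^sup>2 * (complexity \<delta> K - 4 / 5 * card K)"
    using low_noise_bound[OF assms(1,2) noise \<theta>] C_pen_bounds(2)[of X \<sigma> K]
    by (simp add: N_def kl_def)
  also have "\<dots> \<le> 5 / 4 * (norm (proj_mat X K *v \<mu> - \<mu>))\<^sup>2 + 64 * \<sigma>\<^sup>2 * complexity \<delta> K"
    by (simp add: algebra_simps)
  also have "\<dots> \<le> 5 / 4 * ((norm (proj_mat X K *v \<mu> - \<mu>))\<^sup>2 + (16 * \<sigma>)\<^sup>2 / 4 * complexity \<delta> K)"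
    using complexity_nonneg[OF assms(2,3), of K] by (simp add: power_mult_distrib algebra_simps)
  finally show ?thesis
    using jensen by (simp add: EW_aggregate_def y_def m_def \<theta>_def)
qed

section \<open>Sparse approximation and the remainder term\<close>

lemma power_div_fact_le_exp:
  fixes a :: real
  assumes "0 \<le> a"
  shows "a ^ k / fact k \<le> exp a"
proof -
  have "(\<Sum>n\<in>{k}. a ^ n /\<^sub>R fact n) \<le> (\<Sum>n. a ^ n /\<^sub>R fact n)"
    using assms by (intro sum_le_suminf summable_exp_generic) auto
  then show ?thesis by (simp add: exp_def divide_inverse mult.commute)
qed

text \<open>At \<open>a = k\<close> this is the usual bound \<open>k ln (e p / k)\<close>; for other values of \<open>a\<close> it is the tangent to this concave
function of \<open>k\<close> at \<open>a\<close>. A bound that is affine in the size of the support is what rounding can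
control.\<close>

lemma ln_choose_le:
  fixes a :: real
  assumes "k \<le> p" "0 < p" "0 < a"
  shows "ln (p choose k) \<le> a + k * ln (p / a)"
proof -
  have "real ((p choose k) * fact k) \<le> real (p ^ k)"
    by (rule of_nat_mono[OF binomial_fact_pow])
  then have "real (p choose k) \<le> p ^ k / fact k"
    by (simp add: field_simps)
  also have "\<dots> = (p / a) ^ k * (a ^ k / fact k)"
    using assms by (simp add: power_divide)
  also have "\<dots> \<le> (p / a) ^ k * exp a"
    using assms by (intro mult_left_mono power_div_fact_le_exp) auto
  finally have "ln (p choose k) \<le> ln ((p / a) ^ k * exp a)"
    using assms by (subst ln_le_cancel_iff) auto
  also have "\<dots> = a + k * ln (p / a)"
    using assms by (simp add: ln_mult ln_realpow)
  finally show ?thesis .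
qed

text \<open>Replacing the coefficient \<open>b\<close> by \<open>t sgn b\<close> with probability \<open>|b| / t\<close> and by \<open>0\<close> otherwise is unbiased. The
squared error therefore grows in the mean by at most the variance \<open>B\<^sup>2 t |b|\<close>, and the expected cost of a
nonzero coefficient is \<open>c |b| / t\<close>. One of the two values does at least as well as the mean;
fixing the coefficients one after the other replaces the probabilistic argument.\<close>

lemma derandomized_rounding:
  fixes X :: "real^'p^'n" and c :: real
  assumes t: "0 < t" and col: "\<And>j. (norm (column j X))\<^sup>2 \<le> B\<^sup>2" and c: "0 \<le> c"
    and S: "finite S" "\<And>j. j \<in> S \<Longrightarrow> \<bar>\<beta> $ j\<bar> \<le> t"
  shows "\<exists>\<beta>'. (\<forall>j. j \<notin> S \<longrightarrow> \<beta>' $ j = \<beta> $ j) \<and>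
    (norm (X *v \<beta>' - \<mu>))\<^sup>2 + c * card {j\<in>S. \<beta>' $ j \<noteq> 0}
      \<le> (norm (X *v \<beta> - \<mu>))\<^sup>2 + (\<Sum>j\<in>S. (B\<^sup>2 * t\<^sup>2 + c) * (\<bar>\<beta> $ j\<bar> / t))"
  using S
proof (induction S rule: finite_induct)
  case empty
  then show ?case by auto
next
  case (insert e F)
  then obtain \<beta>1 where \<beta>1: "\<And>j. j \<notin> F \<Longrightarrow> \<beta>1 $ j = \<beta> $ j"
    "(norm (X *v \<beta>1 - \<mu>))\<^sup>2 + c * card {j\<in>F. \<beta>1 $ j \<noteq> 0}
      \<le> (norm (X *v \<beta> - \<mu>))\<^sup>2 + (\<Sum>j\<in>F. (B\<^sup>2 * t\<^sup>2 + c) * (\<bar>\<beta> $ j\<bar> / t))"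
    by auto
  define b where "b = \<beta> $ e"
  define r where "r = \<bar>b\<bar> / t"
  define s where "s = t * sgn b"
  define w where "w = X *v \<beta>1 - \<mu>"
  define v where "v = column e X"
  define T where "T = (norm w)\<^sup>2 + (B\<^sup>2 * t\<^sup>2 + c) * r"
  define \<beta>2 where "\<beta>2 z = \<beta>1 + axis e (z - b)" for z
  have r: "0 \<le> r" "r \<le> 1" using insert.prems[of e] t by (auto simp: r_def b_def)
  have rs: "r * s = b" using t by (simp add: r_def s_def abs_mult_sgn)
  have rss: "r * s\<^sup>2 \<le> r * t\<^sup>2"
    using r(1) by (intro mult_left_mono) (auto simp: s_def power_mult_distrib sgn_if)
  have X\<beta>2: "X *v \<beta>2 z - \<mu> = w + (z - b) *\<^sub>R v" for z
  proof -
    have "axis e (z - b) = (z - b) *\<^sub>R axis e (1::real)" by (simp add: axis_def vec_eq_iff)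
    then have "X *v axis e (z - b) = (z - b) *\<^sub>R v"
      by (simp add: matrix_vector_mult_scaleR matrix_vector_mult_basis v_def)
    then show ?thesis by (simp add: \<beta>2_def w_def matrix_vector_right_distrib)
  qed
  \<comment> \<open>The witness is one of the values \<open>0\<close> and \<open>s\<close>: their average with the weights \<open>1 - r\<close> and \<open>r\<close> is at
    most \<open>T\<close>.\<close>
  have choice: "\<exists>z. (norm (w + (z - b) *\<^sub>R v))\<^sup>2 + c * of_bool (z \<noteq> 0) \<le> T"
  proof (rule ccontr)
    assume "\<not> ?thesis"
    then have gt: "T < (norm (w + (z - b) *\<^sub>R v))\<^sup>2 + c * of_bool (z \<noteq> 0)" for z
      by (auto simp: not_le)
    have g0: "T < (norm (w + (0 - b) *\<^sub>R v))\<^sup>2" using gt[of 0] by simp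
    have gs: "T < (norm (w + (s - b) *\<^sub>R v))\<^sup>2 + c" using gt[of s] c by (cases "s = 0") auto
    have "T < (1 - r) * (norm (w + (0 - b) *\<^sub>R v))\<^sup>2 + r * ((norm (w + (s - b) *\<^sub>R v))\<^sup>2 + c)"
    proof (cases "r = 1")
      case True then show ?thesis using gs by simp
    next
      case False
      have "(1 - r) * T < (1 - r) * (norm (w + (0 - b) *\<^sub>R v))\<^sup>2"
        using g0 r False by simp
      moreover have "r * T \<le> r * ((norm (w + (s - b) *\<^sub>R v))\<^sup>2 + c)"
        using gs r by (intro mult_left_mono) auto
      ultimately show ?thesis by (simp add: algebra_simps)
    qed
    also have "\<dots> = (norm w)\<^sup>2 + (r * s\<^sup>2 - b\<^sup>2) * (norm v)\<^sup>2 + r * c"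
      unfolding rs[symmetric] power2_norm_eq_inner
      by (simp add: inner_add_left inner_add_right inner_commute power2_eq_square algebra_simps)
    also have "\<dots> \<le> (norm w)\<^sup>2 + (r * t\<^sup>2) * B\<^sup>2 + r * c"
    proof -
      have "(r * s\<^sup>2 - b\<^sup>2) * (norm v)\<^sup>2 \<le> (r * t\<^sup>2) * (norm v)\<^sup>2"
        using rss by (intro mult_right_mono) (auto intro: order_trans[of _ "r * s\<^sup>2"])
      also have "\<dots> \<le> (r * t\<^sup>2) * B\<^sup>2"
        using col[of e] r(1) by (intro mult_left_mono) (auto simp: v_def)
      finally show ?thesis by simp
    qed
    also have "\<dots> = T" by (simp add: T_def algebra_simps)
    finally show False by simp
  qed
  then obtain z where z: "(norm (w + (z - b) *\<^sub>R v))\<^sup>2 + c * of_bool (z \<noteq> 0) \<le> T" by blast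
  have coef: "\<beta>2 z $ j = (if j = e then z else \<beta>1 $ j)" for j
    using \<beta>1(1)[of e] insert.hyps by (simp add: \<beta>2_def axis_def b_def)
  have "{j \<in> insert e F. \<beta>2 z $ j \<noteq> 0} = (if z \<noteq> 0 then {e} else {}) \<union> {j \<in> F. \<beta>1 $ j \<noteq> 0}"
    using insert.hyps by (auto simp: coef)
  then have card: "card {j \<in> insert e F. \<beta>2 z $ j \<noteq> 0} = of_bool (z \<noteq> 0) + card {j \<in> F. \<beta>1 $ j \<noteq> 0}"
    using insert.hyps by simp
  have "(norm (X *v \<beta>2 z - \<mu>))\<^sup>2 + c * card {j \<in> insert e F. \<beta>2 z $ j \<noteq> 0}
      \<le> T + c * card {j \<in> F. \<beta>1 $ j \<noteq> 0}"
    using z unfolding card X\<beta>2 by (simp add: distrib_left)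
  also have "\<dots> \<le> (norm (X *v \<beta> - \<mu>))\<^sup>2 + (\<Sum>j\<in>insert e F. (B\<^sup>2 * t\<^sup>2 + c) * (\<bar>\<beta> $ j\<bar> / t))"
    using \<beta>1(2) insert.hyps by (simp add: T_def w_def r_def b_def)
  finally show ?case
    using \<beta>1(1) by (intro exI[of _ "\<beta>2 z"]) (auto simp: coef)
qed

text \<open>Coefficients above the threshold are kept. Both \<open>|b| / t\<close> for the small and \<open>1\<close> for the large
coefficients are at most \<open>(|b| / t)\<^sup>q\<close>.\<close>

lemma sparse_approximation:
  fixes X :: "real^'p^'n" and c :: real
  assumes "0 < t" "\<And>j. (norm (column j X))\<^sup>2 \<le> B\<^sup>2" "0 \<le> c" "0 < q" "q \<le> 1"
  shows "\<exists>\<beta>'. (norm (X *v \<beta>' - \<mu>))\<^sup>2 + c * card {j. \<beta>' $ j \<noteq> 0}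
      \<le> (norm (X *v \<beta> - \<mu>))\<^sup>2 + (B\<^sup>2 * t\<^sup>2 + c) * (\<Sum>j\<in>UNIV. (\<bar>\<beta> $ j\<bar> / t) powr q)"
proof -
  define S where "S = {j. \<bar>\<beta> $ j\<bar> \<le> t}"
  obtain \<beta>' where \<beta>': "\<And>j. j \<notin> S \<Longrightarrow> \<beta>' $ j = \<beta> $ j"
    "(norm (X *v \<beta>' - \<mu>))\<^sup>2 + c * card {j\<in>S. \<beta>' $ j \<noteq> 0}
      \<le> (norm (X *v \<beta> - \<mu>))\<^sup>2 + (\<Sum>j\<in>S. (B\<^sup>2 * t\<^sup>2 + c) * (\<bar>\<beta> $ j\<bar> / t))"
    using derandomized_rounding[OF assms(1-3) finite, of S \<beta> \<mu>] unfolding S_def by blast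
  have small: "\<bar>\<beta> $ j\<bar> / t \<le> (\<bar>\<beta> $ j\<bar> / t) powr q" if "j \<in> S" for j
  proof (cases "\<beta> $ j = 0")
    case False
    have "(\<bar>\<beta> $ j\<bar> / t) powr 1 \<le> (\<bar>\<beta> $ j\<bar> / t) powr q"
      using that assms(1,4,5) by (intro powr_mono') (auto simp: S_def)
    then show ?thesis using assms(1) by simp
  qed simp
  have large: "1 \<le> (\<bar>\<beta> $ j\<bar> / t) powr q" if "j \<notin> S" for j
    using that assms(1,4) by (intro ge_one_powr_ge_zero) (auto simp: S_def)
  have "real (card {j. \<beta>' $ j \<noteq> 0}) \<le> card {j\<in>S. \<beta>' $ j \<noteq> 0} + card (- S)"
  proof -
    have "card {j. \<beta>' $ j \<noteq> 0} \<le> card ({j\<in>S. \<beta>' $ j \<noteq> 0} \<union> - S)"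
      by (intro card_mono) auto
    also have "\<dots> \<le> card {j\<in>S. \<beta>' $ j \<noteq> 0} + card (- S)" by (rule card_Un_le)
    finally show ?thesis by linarith
  qed
  then have "c * card {j. \<beta>' $ j \<noteq> 0} \<le> c * (card {j\<in>S. \<beta>' $ j \<noteq> 0} + card (- S))"
    using assms(3) by (intro mult_left_mono) auto
  then have "(norm (X *v \<beta>' - \<mu>))\<^sup>2 + c * card {j. \<beta>' $ j \<noteq> 0}
      \<le> (norm (X *v \<beta> - \<mu>))\<^sup>2 + (\<Sum>j\<in>S. (B\<^sup>2 * t\<^sup>2 + c) * (\<bar>\<beta> $ j\<bar> / t)) + (\<Sum>j\<in>-S. c)"
    using \<beta>'(2) by (simp only: sum_constant distrib_left of_nat_add mult.commute[of c])
  also have "\<dots> \<le> (norm (X *v \<beta> - \<mu>))\<^sup>2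
      + (\<Sum>j\<in>S. (B\<^sup>2 * t\<^sup>2 + c) * (\<bar>\<beta> $ j\<bar> / t) powr q)
      + (\<Sum>j\<in>-S. (B\<^sup>2 * t\<^sup>2 + c) * (\<bar>\<beta> $ j\<bar> / t) powr q)"
  proof (intro add_mono order_refl sum_mono mult_left_mono small)
    fix j assume j: "j \<in> - S"
    have "c * 1 \<le> (B\<^sup>2 * t\<^sup>2 + c) * (\<bar>\<beta> $ j\<bar> / t) powr q"
      using j assms(3) by (intro mult_mono large) auto
    then show "c \<le> (B\<^sup>2 * t\<^sup>2 + c) * (\<bar>\<beta> $ j\<bar> / t) powr q" by simp
  qed (use assms(3) in auto)
  also have "\<dots> = (norm (X *v \<beta> - \<mu>))\<^sup>2 + (B\<^sup>2 * t\<^sup>2 + c) * (\<Sum>j\<in>UNIV. (\<bar>\<beta> $ j\<bar> / t) powr q)"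
    unfolding sum_distrib_left
    using sum.subset_diff[of S UNIV "\<lambda>j. (B\<^sup>2 * t\<^sup>2 + c) * (\<bar>\<beta> $ j\<bar> / t) powr q"]
    by (simp only: Compl_eq_Diff_UNIV) simp
  finally show ?thesis by blast
qed

lemma phi_ge:
  fixes \<beta> :: "real^'p"
  shows "9 * \<tau> powr (2 - q) * lq_pow q \<beta> * B powr q
      * logbar (exp 1 * CARD('p) * \<tau> powr q / (B powr q * lq_pow q \<beta> * \<delta>)) powr (1 - q / 2) \<le> phi q \<beta> \<tau> B \<delta>"
    and "3 * \<tau>\<^sup>2 * logbar (exp 1 * CARD('p) / \<delta>) \<le> phi q \<beta> \<tau> B \<delta>"
  by (simp_all add: phi_def Let_def)

text \<open>The second term in the maximum that defines \<open>\<phi>\<close> covers the confidence level.\<close>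

lemma ln_confidence_le_phi:
  fixes \<beta> :: "real^'p"
  assumes "0 < \<delta>"
  shows "\<tau>\<^sup>2 / 4 * ln (2 / \<delta>) \<le> phi q \<beta> \<tau> B \<delta> / 12"
proof -
  have "2 / \<delta> \<le> exp 1 * CARD('p) / \<delta>"
  proof (rule divide_right_mono)
    have "2 \<le> exp (1::real)" using exp_ge_add_one_self[of "1::real"] by simp
    moreover have "1 \<le> real CARD('p)" by (simp add: Suc_leI)
    ultimately show "2 \<le> exp 1 * real CARD('p)" using mult_mono[of 2 "exp (1::real)" 1 "real CARD('p)"] by simp
  qed (use assms in simp)
  then have "ln (2 / \<delta>) \<le> logbar (exp 1 * CARD('p) / \<delta>)"
    using assms unfolding logbar_def by (intro max.coboundedI1) simp
  then have "\<tau>\<^sup>2 / 4 * ln (2 / \<delta>) \<le> \<tau>\<^sup>2 / 4 * logbar (exp 1 * CARD('p) / \<delta>)"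
    by (intro mult_left_mono) auto
  also have "\<dots> \<le> phi q \<beta> \<tau> B \<delta> / 12" using phi_ge(2)[of \<tau> \<delta> q \<beta> B] by simp
  finally show ?thesis .
qed

lemma proj_mat_support_error:
  fixes X :: "real^'p^'n"
  shows "(norm (proj_mat X {j. \<beta> $ j \<noteq> 0} *v \<mu> - \<mu>))\<^sup>2 \<le> (norm (X *v \<beta> - \<mu>))\<^sup>2"
  using proj_mat_pythagoras[OF mult_vec_in_span_columns[OF order_refl], of \<mu> X \<beta>]
  by (simp add: norm_minus_commute)

lemma sparsity_oracle_zero:
  fixes X :: "real^'p^'n"
  assumes "0 < \<delta>"
  shows "\<exists>K. (norm (proj_mat X K *v \<mu> - \<mu>))\<^sup>2 + \<tau>\<^sup>2 / 4 * complexity \<delta> K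
    \<le> (norm (X *v 0 - \<mu>))\<^sup>2 + phi q (0 :: real^'p) \<tau> B \<delta>"
proof
  have empty: "complexity \<delta> ({} :: 'p set) = ln (2 / \<delta>)" by (simp add: complexity_def)
  have "(norm (proj_mat X {} *v \<mu> - \<mu>))\<^sup>2 \<le> (norm (X *v 0 - \<mu>))\<^sup>2"
    using proj_mat_support_error[of X 0 \<mu>] by simp
  then show "(norm (proj_mat X {} *v \<mu> - \<mu>))\<^sup>2 + \<tau>\<^sup>2 / 4 * complexity \<delta> ({} :: 'p set)
    \<le> (norm (X *v 0 - \<mu>))\<^sup>2 + phi q (0 :: real^'p) \<tau> B \<delta>"
    unfolding empty using ln_confidence_le_phi[OF assms, of \<tau> q "0 :: real^'p" B]
      phi_nonneg[of q "0 :: real^'p" \<tau> B \<delta>] by linarith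
qed

lemma sparsity_oracle_l0:
  fixes X :: "real^'p^'n"
  assumes "0 < \<delta>" "\<delta> < 1" "\<beta> \<noteq> 0" "0 < \<tau>" "0 < B"
  shows "\<exists>K. (norm (proj_mat X K *v \<mu> - \<mu>))\<^sup>2 + \<tau>\<^sup>2 / 4 * complexity \<delta> K
    \<le> (norm (X *v \<beta> - \<mu>))\<^sup>2 + phi 0 \<beta> \<tau> B \<delta>"
proof
  define K where "K = {j. \<beta> $ j \<noteq> 0}"
  define k where "k = card K"
  define p where "p = CARD('p)"
  have "K \<noteq> {}" using assms(3) by (auto simp: K_def vec_eq_iff)
  then have k: "0 < k" by (simp add: k_def card_gt_0_iff)
  have kp: "k \<le> p" unfolding k_def p_def by (intro card_mono) auto
  define L where "L = logbar (exp 1 * p / (k * \<delta>))"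
  have L: "1 \<le> L" by (simp add: L_def logbar_def)
  have lnL: "1 + ln (p / k) \<le> L"
  proof -
    have "1 + ln (p / k) - ln \<delta> = ln (exp 1 * p / (k * \<delta>))"
      using k kp assms(1) by (simp add: ln_div ln_mult)
    also have "\<dots> \<le> L" by (simp add: L_def logbar_def)
    finally show ?thesis using assms(1,2) ln_less_zero[of \<delta>] by linarith
  qed
  have "lq_pow 0 \<beta> = k" using assms(3) by (simp add: lq_pow_def l0_def k_def K_def)
  then have phi: "9 * \<tau>\<^sup>2 * (k * L) \<le> phi 0 \<beta> \<tau> B \<delta>"
    using phi_ge(1)[of \<tau> 0 \<beta> B \<delta>] assms(4,5) L by (simp add: L_def p_def powr_numeral mult.assoc)
  have "ln (p choose k) \<le> k + k * ln (p / k)"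
    using ln_choose_le[OF kp, of "real k"] k kp by simp
  also have "\<dots> = k * (1 + ln (p / k))" by (simp add: algebra_simps)
  also have "\<dots> \<le> k * L" using lnL by (intro mult_left_mono) auto
  finally have "2 * k + ln (p choose k) \<le> 3 * (k * L)"
    using mult_left_mono[OF L, of "real k"] by simp
  then have "complexity \<delta> K \<le> 3 * (k * L) + ln (2 / \<delta>)"
    by (simp add: complexity_def k_def p_def)
  then have "\<tau>\<^sup>2 / 4 * complexity \<delta> K \<le> \<tau>\<^sup>2 / 4 * (3 * (k * L) + ln (2 / \<delta>))"
    by (intro mult_left_mono) auto
  also have "\<dots> = 3 / 4 * (\<tau>\<^sup>2 * (k * L)) + \<tau>\<^sup>2 / 4 * ln (2 / \<delta>)" by (simp add: algebra_simps)
  also have "\<dots> \<le> phi 0 \<beta> \<tau> B \<delta>"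
    using phi ln_confidence_le_phi[OF assms(1), of \<tau> 0 \<beta> B] phi_nonneg[of 0 \<beta> \<tau> B \<delta>] by linarith
  finally show "(norm (proj_mat X K *v \<mu> - \<mu>))\<^sup>2 + \<tau>\<^sup>2 / 4 * complexity \<delta> K
    \<le> (norm (X *v \<beta> - \<mu>))\<^sup>2 + phi 0 \<beta> \<tau> B \<delta>"
    using proj_mat_support_error[of X \<beta> \<mu>] unfolding K_def by linarith
qed

text \<open>The threshold is \<open>t = \<tau> \<surd>L / B\<close>, where \<open>L\<close> is the logarithmic factor in \<open>\<phi>\<close>. It makes the variance
\<open>B\<^sup>2 t\<^sup>2 = \<tau>\<^sup>2 L\<close> per selected coefficient comparable to the price of a coefficient, so that everything is
of order \<open>\<tau>\<^sup>2 L m\<close> with \<open>m = |\<beta>|\<^sub>q\<^sup>q / t\<^sup>q\<close>; this is one ninth of the first term of \<open>\<phi>\<close>.\<close>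

lemma sparsity_oracle_lq:
  fixes X :: "real^'p^'n"
  assumes "0 < \<delta>" "\<delta> < 1" "\<beta> \<noteq> 0" "0 < \<tau>" "0 < B" "0 < q" "q \<le> 1"
    and col: "\<And>j. (norm (column j X))\<^sup>2 \<le> B\<^sup>2"
  shows "\<exists>K. (norm (proj_mat X K *v \<mu> - \<mu>))\<^sup>2 + \<tau>\<^sup>2 / 4 * complexity \<delta> K
    \<le> (norm (X *v \<beta> - \<mu>))\<^sup>2 + phi q \<beta> \<tau> B \<delta>"
proof -
  define S where "S = (\<Sum>j\<in>UNIV. \<bar>\<beta> $ j\<bar> powr q)"
  define p where "p = CARD('p)"
  define R where "R = p * \<tau> powr q / (B powr q * S)"
  define L where "L = logbar (exp 1 * p * \<tau> powr q / (B powr q * S * \<delta>))"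
  define t where "t = \<tau> * sqrt L / B"
  define m where "m = (\<Sum>j\<in>UNIV. (\<bar>\<beta> $ j\<bar> / t) powr q)"
  \<comment> \<open>The expected size of the support is at most \<open>m\<close>, so this is the natural point for the tangent
    to the complexity; beyond \<open>p\<close> the slope could be negative.\<close>
  define a where "a = min m p"
  define c where "c = \<tau>\<^sup>2 / 4 * (2 + ln (p / a))"
  have p: "p > 0" by (simp add: p_def)
  obtain i where "\<beta> $ i \<noteq> 0" using assms(3) by (auto simp: vec_eq_iff)
  then have S: "S > 0" unfolding S_def by (intro sum_pos2[of UNIV i]) auto
  have R: "R > 0" using p S assms by (simp add: R_def)
  have L: "1 \<le> L" by (simp add: L_def logbar_def)
  have t: "t > 0" using L assms by (simp add: t_def)
  have tq: "t powr q = \<tau> powr q * L powr (q / 2) / B powr q"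
    using L assms by (simp add: t_def powr_divide powr_mult powr_half_sqrt[symmetric] powr_powr)
  have m_eq: "m = S / t powr q"
    using t by (simp add: m_def S_def powr_divide sum_divide_distrib)
  have m: "m > 0" using S t by (simp add: m_eq)
  have lnL: "1 + ln R \<le> L"
  proof -
    have "1 + ln R - ln \<delta> = ln (exp 1 * p * \<tau> powr q / (B powr q * S * \<delta>))"
      using p S assms by (simp add: R_def ln_div ln_mult)
    also have "\<dots> \<le> L" by (simp add: L_def logbar_def)
    finally show ?thesis using assms(1,2) ln_less_zero[of \<delta>] by linarith
  qed
  have lq: "lq_pow q \<beta> = S"
    using assms(6) S by (simp add: lq_pow_def lq_def powr_powr flip: S_def)
  have Lm: "\<tau>\<^sup>2 * (L * m) = \<tau> powr (2 - q) * S * B powr q * L powr (1 - q / 2)"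
  proof -
    have "\<tau> powr (2 - q) = \<tau>\<^sup>2 / \<tau> powr q" "L powr (1 - q / 2) = L / L powr (q / 2)"
      using L assms by (simp_all only: powr_diff) (simp_all add: powr_numeral)
    then show ?thesis using L assms by (simp add: m_eq tq)
  qed
  have phi: "9 * (\<tau>\<^sup>2 * (L * m)) \<le> phi q \<beta> \<tau> B \<delta>"
    using phi_ge(1)[of \<tau> q \<beta> B \<delta>] unfolding lq Lm unfolding L_def p_def by (simp add: mult_ac)
  have a: "0 < a" "a \<le> p" "a \<le> m" using m p by (auto simp: a_def)
  have c: "0 \<le> c" using a p by (simp add: c_def)
  have main: "(2 + ln (p / a)) * m + a \<le> 7 / 2 * (L * m)"
  \<comment> \<open>If \<open>m > p\<close>, then the tangent at \<open>p\<close> has no logarithm and \<open>L \<ge> 1\<close> suffices.\<close>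
  proof (cases "m \<le> p")
    case True
    then have "a = m" by (simp add: a_def)
    have "p / m = R * L powr (q / 2)"
      using S by (simp add: m_eq tq R_def mult_ac)
    then have "ln (p / m) = ln R + q / 2 * ln L"
      using R L by (simp add: ln_mult ln_powr)
    moreover have "q / 2 * ln L \<le> 1 / 2 * L"
    proof (rule mult_mono)
      show "ln L \<le> L" using ln_le_minus_one[of L] L by simp
    qed (use assms L in auto)
    ultimately have "3 + ln (p / m) \<le> 7 / 2 * L" using lnL L by simp
    then have "(3 + ln (p / m)) * m \<le> 7 / 2 * L * m" using m by (intro mult_right_mono) auto
    then show ?thesis using \<open>a = m\<close> by (simp add: algebra_simps)
  next
    case False
    then have "a = p" by (simp add: a_def)
    then have ln0: "ln (p / a) = 0" using p by simp
    have "(2 + ln (p / a)) * m + a \<le> 7 / 2 * (1 * m)"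
      unfolding ln0 using False \<open>a = p\<close> m by simp
    also have "\<dots> \<le> 7 / 2 * (L * m)"
      using L m by (intro mult_left_mono mult_right_mono) auto
    finally show ?thesis .
  qed
  obtain \<beta>' where \<beta>': "(norm (X *v \<beta>' - \<mu>))\<^sup>2 + c * card {j. \<beta>' $ j \<noteq> 0}
      \<le> (norm (X *v \<beta> - \<mu>))\<^sup>2 + (B\<^sup>2 * t\<^sup>2 + c) * m"
    using sparse_approximation[OF t col c assms(6,7), of \<mu> \<beta>] by (auto simp: m_def)
  have Bt: "B\<^sup>2 * t\<^sup>2 = \<tau>\<^sup>2 * L"
    using assms L by (simp add: t_def power_mult_distrib power_divide)
  define K where "K = {j. \<beta>' $ j \<noteq> 0}"
  have "ln (p choose card K) \<le> a + card K * ln (p / a)"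
    using p a unfolding p_def by (intro ln_choose_le card_mono) auto
  then have "complexity \<delta> K \<le> card K * (2 + ln (p / a)) + a + ln (2 / \<delta>)"
    by (simp add: complexity_def p_def algebra_simps)
  then have "\<tau>\<^sup>2 / 4 * complexity \<delta> K \<le> \<tau>\<^sup>2 / 4 * (card K * (2 + ln (p / a)) + a + ln (2 / \<delta>))"
    by (intro mult_left_mono) auto
  also have "\<dots> = c * card K + \<tau>\<^sup>2 / 4 * a + \<tau>\<^sup>2 / 4 * ln (2 / \<delta>)"
    by (simp add: c_def algebra_simps)
  finally have comp: "\<tau>\<^sup>2 / 4 * complexity \<delta> K \<le> c * card K + \<tau>\<^sup>2 / 4 * a + \<tau>\<^sup>2 / 4 * ln (2 / \<delta>)" .
  have "(norm (proj_mat X K *v \<mu> - \<mu>))\<^sup>2 + \<tau>\<^sup>2 / 4 * complexity \<delta> K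
      \<le> (norm (X *v \<beta> - \<mu>))\<^sup>2 + (\<tau>\<^sup>2 * L + c) * m + \<tau>\<^sup>2 / 4 * a + \<tau>\<^sup>2 / 4 * ln (2 / \<delta>)"
    using proj_mat_support_error[of X \<beta>' \<mu>] comp \<beta>' unfolding K_def Bt by linarith
  also have "\<dots> = (norm (X *v \<beta> - \<mu>))\<^sup>2 + \<tau>\<^sup>2 * (L * m)
      + \<tau>\<^sup>2 / 4 * ((2 + ln (p / a)) * m + a) + \<tau>\<^sup>2 / 4 * ln (2 / \<delta>)"
    by (simp add: c_def algebra_simps)
  also have "\<dots> \<le> (norm (X *v \<beta> - \<mu>))\<^sup>2 + \<tau>\<^sup>2 * (L * m)
      + \<tau>\<^sup>2 / 4 * (7 / 2 * (L * m)) + \<tau>\<^sup>2 / 4 * ln (2 / \<delta>)"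
    using main by (intro add_mono mult_left_mono order_refl) auto
  also have "\<dots> \<le> (norm (X *v \<beta> - \<mu>))\<^sup>2 + phi q \<beta> \<tau> B \<delta>"
    using phi ln_confidence_le_phi[OF assms(1), of \<tau> q \<beta> B] phi_nonneg[of q \<beta> \<tau> B \<delta>] by (simp add: mult_ac)
  finally show ?thesis by blast
qed

text \<open>The sets \<open>K\<close> are finitely many, so one of them is best for all \<open>q\<close> and \<open>\<beta>\<close> at once; the infimum over
\<open>q\<close> and \<open>\<beta>\<close> itself need not be attained.\<close>

lemma sparsity_oracle:
  fixes X :: "real^'p^'n"
  assumes "0 < \<delta>" "\<delta> < 1" "0 < \<tau>" "0 < B" "\<And>j. (norm (column j X))\<^sup>2 \<le> B\<^sup>2"
  obtains K where "(norm (proj_mat X K *v \<mu> - \<mu>))\<^sup>2 + \<tau>\<^sup>2 / 4 * complexity \<delta> K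
    \<le> (INF q\<in>{0..1}. INF \<beta>. (norm (X *v \<beta> - \<mu>))\<^sup>2 + phi q \<beta> \<tau> B \<delta>)"
proof -
  define risk where "risk K = (norm (proj_mat X K *v \<mu> - \<mu>))\<^sup>2 + \<tau>\<^sup>2 / 4 * complexity \<delta> K" for K
  obtain K where K: "\<And>J. risk K \<le> risk J"
    using ex_min_if_finite[of "range risk"] by (auto simp: not_less)
  have "risk K \<le> (norm (X *v \<beta> - \<mu>))\<^sup>2 + phi q \<beta> \<tau> B \<delta>" if q: "q \<in> {0..1}" for q \<beta>
  proof -
    have "\<exists>J. risk J \<le> (norm (X *v \<beta> - \<mu>))\<^sup>2 + phi q \<beta> \<tau> B \<delta>"
      unfolding risk_def
      using q assms sparsity_oracle_zero[OF assms(1)] sparsity_oracle_l0[of \<delta> \<beta> \<tau> B X \<mu>]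
        sparsity_oracle_lq[of \<delta> \<beta> \<tau> B q X \<mu>]
      by (cases "\<beta> = 0"; cases "q = 0") auto
    then show ?thesis using K order_trans by blast
  qed
  then have "risk K \<le> (INF q\<in>{0..1}. INF \<beta>. (norm (X *v \<beta> - \<mu>))\<^sup>2 + phi q \<beta> \<tau> B \<delta>)"
    by (intro cINF_greatest) auto
  then show ?thesis using that unfolding risk_def by blast
qed

section \<open>Continuity of the estimators\<close>

text \<open>Averages of projections, and of the complementary projections, are contractions.\<close>

lemma norm_mix_diff_le:
  fixes X :: "real^'p^'n"
  assumes "\<theta> \<in> prob_vectors"
  shows "norm (mix X y \<theta> - mix X z \<theta>) \<le> norm (y - z)"
    and "norm (y - mix X y \<theta>) \<le> norm y"
    and "norm ((y - mix X y \<theta>) - (z - mix X z \<theta>)) \<le> norm (y - z)"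
proof -
  have \<theta>: "\<And>J. 0 \<le> \<theta> $ J" "(\<Sum>J\<in>UNIV. \<theta> $ J) = 1"
    using assms by (auto simp: prob_vectors_def)
  have avg: "norm (\<Sum>J\<in>UNIV. \<theta> $ J *\<^sub>R g J) \<le> r" if "\<And>J. norm (g J) \<le> r" for g :: "'p set \<Rightarrow> real^'n" and r
  proof -
    have "norm (\<Sum>J\<in>UNIV. \<theta> $ J *\<^sub>R g J) \<le> (\<Sum>J\<in>UNIV. \<theta> $ J * norm (g J))"
      using \<theta>(1) norm_sum[of "\<lambda>J. \<theta> $ J *\<^sub>R g J" UNIV] by simp
    also have "\<dots> \<le> r"
      using prob_vector_average_mono[OF assms that, of "\<lambda>J. J"] prob_vector_average_const[OF assms, of r]
      by simp
    finally show ?thesis .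
  qed
  have residual: "u - mix X u \<theta> = (\<Sum>J\<in>UNIV. \<theta> $ J *\<^sub>R (u - proj_mat X J *v u))" for u
    using \<theta>(2) by (simp add: mix_def least_squares_def scaleR_diff_right sum_subtractf
        flip: scaleR_sum_left)
  have diff: "mix X y \<theta> - mix X z \<theta> = mix X (y - z) \<theta>"
    by (simp add: mix_def least_squares_def matrix_vector_mult_diff_distrib scaleR_diff_right sum_subtractf)
  show "norm (mix X y \<theta> - mix X z \<theta>) \<le> norm (y - z)"
    unfolding diff unfolding mix_def least_squares_def by (intro avg norm_proj_mat_le)
  have res: "norm (u - mix X u \<theta>) \<le> norm u" for u
    unfolding residual by (intro avg norm_proj_mat_residual_le)
  show "norm (y - mix X y \<theta>) \<le> norm y" by (rule res)
  have "(y - mix X y \<theta>) - (z - mix X z \<theta>) = (y - z) - mix X (y - z) \<theta>"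
    unfolding diff[symmetric] by simp
  then show "norm ((y - mix X y \<theta>) - (z - mix X z \<theta>)) \<le> norm (y - z)"
    using res[of "y - z"] by (simp only:)
qed

lemma abs_diff_squares_le:
  fixes a b :: "'a::real_normed_vector"
  assumes "norm a \<le> r" "norm b \<le> s" "norm (a - b) \<le> d"
  shows "\<bar>(norm a)\<^sup>2 - (norm b)\<^sup>2\<bar> \<le> d * (r + s)"
proof -
  have "\<bar>(norm a)\<^sup>2 - (norm b)\<^sup>2\<bar> = \<bar>norm a - norm b\<bar> * (norm a + norm b)"
    by (simp add: power2_eq_square square_diff_square_factored abs_mult mult.commute)
  also have "\<dots> \<le> d * (r + s)"
    using assms norm_triangle_ineq3[of a b] norm_ge_zero[of "a - b"]
    by (intro mult_mono add_mono) (linarith | simp)+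
  finally show ?thesis .
qed

lemma Q_fun_diff_le:
  fixes X :: "real^'p^'n"
  assumes "\<theta> \<in> prob_vectors"
  shows "\<bar>Q_fun X \<sigma> (1 / 2) lam y \<theta> - Q_fun X \<sigma> (1 / 2) lam z \<theta>\<bar> \<le> norm (y - z) * (norm y + norm z)"
proof -
  define D where "D = norm (y - z) * (norm y + norm z)"
  have sep: "\<bar>(norm (y - least_squares X J y))\<^sup>2 - (norm (z - least_squares X J z))\<^sup>2\<bar> \<le> D" for J
  proof -
    have "(y - proj_mat X J *v y) - (z - proj_mat X J *v z) = (y - z) - proj_mat X J *v (y - z)"
      by (simp add: matrix_vector_mult_diff_distrib)
    then have "norm ((y - proj_mat X J *v y) - (z - proj_mat X J *v z)) \<le> norm (y - z)"
      by (simp only: norm_proj_mat_residual_le)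
    then show ?thesis
      unfolding least_squares_def D_def by (intro abs_diff_squares_le norm_proj_mat_residual_le)
  qed
  have le: "(\<Sum>J\<in>UNIV. \<theta> $ J * g J) - (\<Sum>J\<in>UNIV. \<theta> $ J * h J) \<le> D"
    if "\<And>J. g J - h J \<le> D" for g h
    using prob_vector_average_mono[OF assms that, of "\<lambda>J. J"] prob_vector_average_const[OF assms, of D]
    by (simp add: right_diff_distrib sum_subtractf)
  define u where "u = (\<Sum>J\<in>UNIV. \<theta> $ J * (norm (y - least_squares X J y))\<^sup>2)
    - (\<Sum>J\<in>UNIV. \<theta> $ J * (norm (z - least_squares X J z))\<^sup>2)"
  define v where "v = (norm (y - mix X y \<theta>))\<^sup>2 - (norm (z - mix X z \<theta>))\<^sup>2"
  have "\<bar>u\<bar> \<le> D"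
    unfolding u_def abs_le_iff minus_diff_eq
    by (intro conjI le) (use sep in \<open>simp_all add: abs_le_iff\<close>)
  moreover have "\<bar>v\<bar> \<le> D"
    unfolding v_def D_def by (intro abs_diff_squares_le norm_mix_diff_le[OF assms])
  moreover have "Q_fun X \<sigma> (1 / 2) lam y \<theta> - Q_fun X \<sigma> (1 / 2) lam z \<theta> = u / 2 + v / 2"
    by (simp add: Q_fun_def u_def v_def diff_divide_distrib)
  ultimately show ?thesis unfolding D_def by linarith
qed

text \<open>The weights of a minimizer may vary with the observation, but strong convexity bounds the distance of the
aggregates by the difference of the criteria at the two observations, which is small uniformly
in the weights because entropy and penalties cancel.\<close>

lemma continuous_Q_aggregate:
  fixes X :: "real^'p^'n"
  assumes agg: "is_Q_aggregate X \<sigma> (1 / 2) lam muhat" and lam: "0 \<le> lam"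
  shows "continuous_on UNIV muhat"
proof -
  have modulus: "norm (muhat z - muhat y) \<le> norm (z - y) + sqrt (4 * (norm (z - y) * (norm z + norm y)))" for y z
  proof -
    obtain \<theta> where \<theta>: "is_arg_min (Q_fun X \<sigma> (1 / 2) lam y) (\<lambda>\<theta>. \<theta> \<in> prob_vectors) \<theta>" "muhat y = mix X y \<theta>"
      using agg unfolding is_Q_aggregate_def by blast
    obtain \<eta> where \<eta>: "is_arg_min (Q_fun X \<sigma> (1 / 2) lam z) (\<lambda>\<theta>. \<theta> \<in> prob_vectors) \<eta>" "muhat z = mix X z \<eta>"
      using agg unfolding is_Q_aggregate_def by blast
    have p: "\<theta> \<in> prob_vectors" "\<eta> \<in> prob_vectors" using \<theta>(1) \<eta>(1) by (auto simp: is_arg_min_def)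
    define Q where "Q = Q_fun X \<sigma> (1 / 2) lam"
    define D where "D = norm (z - y) * (norm z + norm y)"
    have "Q y \<theta> + (norm (mix X y \<eta> - mix X y \<theta>))\<^sup>2 / 2 \<le> Q y \<eta>"
      unfolding Q_def by (rule Q_fun_strong_convexity[OF \<theta>(1) p(2) lam])
    moreover have "Q z \<eta> \<le> Q z \<theta>"
      using \<eta>(1) p(1) by (simp add: Q_def is_arg_min_linorder)
    moreover have "Q z \<theta> - Q y \<theta> \<le> D" "- (Q z \<eta> - Q y \<eta>) \<le> D"
      unfolding Q_def D_def
      using Q_fun_diff_le[OF p(1), of X \<sigma> lam z y] Q_fun_diff_le[OF p(2), of X \<sigma> lam z y]
      by (blast dest: abs_le_D1 abs_le_D2)+
    ultimately have "(norm (mix X y \<eta> - mix X y \<theta>))\<^sup>2 \<le> 4 * D"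
      by argo
    then have "(norm (mix X y \<eta> - mix X y \<theta>))\<^sup>2 \<le> 4 * (norm (z - y) * (norm z + norm y))"
      by (simp only: D_def)
    then have "norm (mix X y \<eta> - mix X y \<theta>) \<le> sqrt (4 * (norm (z - y) * (norm z + norm y)))"
      by (rule real_le_rsqrt)
    moreover have "norm (mix X z \<eta> - mix X y \<eta>) \<le> norm (z - y)"
      by (rule norm_mix_diff_le(1)[OF p(2)])
    ultimately show ?thesis
      unfolding \<theta>(2) \<eta>(2) using norm_triangle_ineq[of "mix X z \<eta> - mix X y \<eta>" "mix X y \<eta> - mix X y \<theta>"]
      by simp
  qed
  have "(muhat \<longlongrightarrow> muhat y) (at y)" for y
  proof -
    have "((\<lambda>z. norm (z - y) + sqrt (4 * (norm (z - y) * (norm z + norm y)))) \<longlongrightarrow>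
        norm (y - y) + sqrt (4 * (norm (y - y) * (norm y + norm y)))) (at y)"
      by (intro tendsto_intros)
    then have lim: "((\<lambda>z. norm (z - y) + sqrt (4 * (norm (z - y) * (norm z + norm y)))) \<longlongrightarrow> 0) (at y)"
      by simp
    have "((\<lambda>z. norm (muhat z - muhat y)) \<longlongrightarrow> 0) (at y)"
      by (rule tendsto_sandwich[OF _ _ tendsto_const lim]) (auto simp: modulus)
    then show ?thesis by (rule LIM_zero_cancel[OF tendsto_norm_zero_cancel])
  qed
  then show ?thesis by (simp add: continuous_on_def)
qed

lemma continuous_EW_aggregate:
  fixes X :: "real^'p^'n"
  shows "continuous_on UNIV (EW_aggregate X \<sigma> lam)"
proof -
  have ls: "continuous_on UNIV (least_squares X J)" for J
    unfolding least_squares_def by (intro linear_continuous_on) (simp add: linear_linear)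
  have w: "continuous_on UNIV (\<lambda>y. EW_weight X \<sigma> lam y J)" for J
    unfolding EW_weight_def divide_inverse by (intro continuous_intros ls)
  have "(\<Sum>K\<in>UNIV. EW_weight X \<sigma> lam y K) \<noteq> 0" for y
  proof -
    have "(\<Sum>K\<in>UNIV. EW_weight X \<sigma> lam y K) > 0"
      by (intro sum_pos) (auto simp: EW_weight_def sparsity_prior_pos)
    then show ?thesis by simp
  qed
  then show ?thesis
    unfolding EW_aggregate_def mix_def by (simp, intro continuous_intros ls w) auto
qed

section \<open>Deviation bounds\<close>

text \<open>Transfers a bound on the deterministic set of low noise to the probability space; continuity of the
estimator provides the measurability.\<close>

lemma (in prob_space) prob_ge_of_low_noise:
  fixes X :: "real^'p^'n" and \<xi> :: "'a \<Rightarrow> real^'n"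
  assumes "0 < \<sigma>" "0 < \<delta>"
    and \<xi>: "distributed M lborel \<xi> (\<lambda>x. ennreal (\<Prod>i\<in>UNIV. normal_density 0 \<sigma> (x $ i)))"
    and f: "continuous_on UNIV f"
    and imp: "\<And>x. low_noise X \<sigma> \<delta> K x \<Longrightarrow> (norm (f (\<mu> + x) - \<mu>))\<^sup>2 \<le> r"
  shows "prob {\<omega> \<in> space M. (norm (f (\<mu> + \<xi> \<omega>) - \<mu>))\<^sup>2 \<le> r} \<ge> 1 - \<delta>"
proof -
  have [measurable]: "\<xi> \<in> borel_measurable M"
    using distributed_measurable[OF \<xi>] by simp
  have [measurable]: "f \<in> borel_measurable borel"
    by (rule borel_measurable_continuous_onI[OF f])
  have "1 - \<delta> \<le> prob {\<omega> \<in> space M. low_noise X \<sigma> \<delta> K (\<xi> \<omega>)}"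
    by (rule prob_low_noise[OF prob_space_axioms assms(1) \<xi> assms(2)])
  also have "\<dots> \<le> prob {\<omega> \<in> space M. (norm (f (\<mu> + \<xi> \<omega>) - \<mu>))\<^sup>2 \<le> r}"
  proof (rule finite_measure_mono)
    show "{\<omega> \<in> space M. low_noise X \<sigma> \<delta> K (\<xi> \<omega>)} \<subseteq> {\<omega> \<in> space M. (norm (f (\<mu> + \<xi> \<omega>) - \<mu>))\<^sup>2 \<le> r}"
      using imp by auto
  qed measurable
  finally show ?thesis .
qed

theorem theorem4:
  fixes M :: "'a measure" and \<xi> :: "'a \<Rightarrow> real^'n" and \<mu> :: "real^'n"
    and X :: "real^'p^'n" and \<sigma> B \<delta> :: real and muQ :: "real^'n \<Rightarrow> real^'n"
  assumes "prob_space M"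
    and "\<sigma> > 0"
    and "distributed M lborel \<xi> (\<lambda>x. ennreal (\<Prod>i\<in>UNIV. normal_density 0 \<sigma> (x $ i)))"
    and "CARD('p) \<ge> 3"
    and "B > 0"
    and "\<And>j. (norm (column j X))\<^sup>2 \<le> B\<^sup>2"
    and "0 < \<delta>" and "\<delta> < 1"
    and "is_Q_aggregate X \<sigma> (1/2) (20 * \<sigma>\<^sup>2) muQ"
  shows "measure M {\<omega> \<in> space M.
            (norm (muQ (\<mu> + \<xi> \<omega>) - \<mu>))\<^sup>2
              \<le> (INF q\<in>{0..1}. INF \<beta>. (norm (X *v \<beta> - \<mu>))\<^sup>2 + phi q \<beta> (9 * \<sigma>) B \<delta>)}
           \<ge> 1 - \<delta>
       \<and> measure M {\<omega> \<in> space M.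
            (norm (EW_aggregate X \<sigma> (64 * \<sigma>\<^sup>2) (\<mu> + \<xi> \<omega>) - \<mu>))\<^sup>2
              \<le> 5 / 3 * (INF q\<in>{0..1}. INF \<beta>. (norm (X *v \<beta> - \<mu>))\<^sup>2 + phi q \<beta> (16 * \<sigma>) B \<delta>)}
           \<ge> 1 - \<delta>"
proof
  interpret prob_space M by fact
  obtain K where K: "(norm (proj_mat X K *v \<mu> - \<mu>))\<^sup>2 + (9 * \<sigma>)\<^sup>2 / 4 * complexity \<delta> K
      \<le> (INF q\<in>{0..1}. INF \<beta>. (norm (X *v \<beta> - \<mu>))\<^sup>2 + phi q \<beta> (9 * \<sigma>) B \<delta>)"
    by (rule sparsity_oracle[of \<delta> "9 * \<sigma>" B X \<mu>]) (use assms in auto)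
  show "measure M {\<omega> \<in> space M. (norm (muQ (\<mu> + \<xi> \<omega>) - \<mu>))\<^sup>2
      \<le> (INF q\<in>{0..1}. INF \<beta>. (norm (X *v \<beta> - \<mu>))\<^sup>2 + phi q \<beta> (9 * \<sigma>) B \<delta>)} \<ge> 1 - \<delta>"
  proof (rule prob_ge_of_low_noise[OF assms(2,7,3)])
    show "continuous_on UNIV muQ" by (rule continuous_Q_aggregate[OF assms(9)]) simp
    fix x assume noise: "low_noise X \<sigma> \<delta> K x"
    obtain \<theta> where \<theta>: "is_arg_min (Q_fun X \<sigma> (1 / 2) (20 * \<sigma>\<^sup>2) (\<mu> + x)) (\<lambda>\<theta>. \<theta> \<in> prob_vectors) \<theta>"
        "muQ (\<mu> + x) = mix X (\<mu> + x) \<theta>"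
      using assms(9) unfolding is_Q_aggregate_def by blast
    show "(norm (muQ (\<mu> + x) - \<mu>))\<^sup>2
        \<le> (INF q\<in>{0..1}. INF \<beta>. (norm (X *v \<beta> - \<mu>))\<^sup>2 + phi q \<beta> (9 * \<sigma>) B \<delta>)"
      unfolding \<theta>(2)
      using Q_aggregate_oracle_inequality[OF assms(2,7) less_imp_le[OF assms(8)] \<theta>(1) noise] K
      by (rule order_trans)
  qed
  obtain K' where K': "(norm (proj_mat X K' *v \<mu> - \<mu>))\<^sup>2 + (16 * \<sigma>)\<^sup>2 / 4 * complexity \<delta> K'
      \<le> (INF q\<in>{0..1}. INF \<beta>. (norm (X *v \<beta> - \<mu>))\<^sup>2 + phi q \<beta> (16 * \<sigma>) B \<delta>)"
    by (rule sparsity_oracle[of \<delta> "16 * \<sigma>" B X \<mu>]) (use assms in auto)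
  show "measure M {\<omega> \<in> space M. (norm (EW_aggregate X \<sigma> (64 * \<sigma>\<^sup>2) (\<mu> + \<xi> \<omega>) - \<mu>))\<^sup>2
      \<le> 5 / 3 * (INF q\<in>{0..1}. INF \<beta>. (norm (X *v \<beta> - \<mu>))\<^sup>2 + phi q \<beta> (16 * \<sigma>) B \<delta>)} \<ge> 1 - \<delta>"
  proof (rule prob_ge_of_low_noise[OF assms(2,7,3) continuous_EW_aggregate])
    fix x assume noise: "low_noise X \<sigma> \<delta> K' x"
    show "(norm (EW_aggregate X \<sigma> (64 * \<sigma>\<^sup>2) (\<mu> + x) - \<mu>))\<^sup>2
        \<le> 5 / 3 * (INF q\<in>{0..1}. INF \<beta>. (norm (X *v \<beta> - \<mu>))\<^sup>2 + phi q \<beta> (16 * \<sigma>) B \<delta>)"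
      using EW_aggregate_oracle_inequality[OF assms(2,7) less_imp_le[OF assms(8)] noise]
        mult_left_mono[OF K']
      by (rule order_trans) simp
  qed
qed

end
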